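(* Let $\Gamma\subset\mathbb R$ be an additive subgroup containing $\mathbb Z$. Every $A\in\mathcal A_\Gamma$ has a unique representation $$A=\sum_{\gamma\in F}M_{p_\gamma}D^\gamma+V_K ,$$ where $F\subset\Gamma$ is finite, $p_\gamma\in\mathbb C[t]$ for $\gamma\in F$, and $K\in\mathcal K_{\mathrm{flat}}$. (Uniqueness means that the coefficients $p_\gamma$, with $p_\gamma:=0$ for $\gamma\notin F$, and the kernel $K$ are determined by $A$.)
   Context: Fix $T>0$; functions are complex-valued. Let $\mathcal M=\{f\in C^\infty[0,T]: f^{(n)}(0)=0\text{ for all }n\ge 0\}$. For $\mu>0$ put $(J^\mu f)(t)=\frac1{\Gamma(\mu)}\int_0^t(t-s)^{\mu-1}f(s)\,ds$ (here $\Gamma(\cdot)$ is the gamma function). On $\mathcal M$ define $D^{-\mu}=J^\mu$ for $\mu>0$, $D^0=I$, and for $\alpha>0$, $D^\alpha f=J^{n-\alpha}f^{(n)}$ for any integer $n>\alpha$ (the common value of the Riemann--Liouville and Caputo derivatives on $\mathcal M$); each $D^\alpha$, $\alpha\in\mathbb R$, is a bijection of $\mathcal M$ and $D^\alpha D^\beta=D^{\alpha+\beta}$. For $p\in\mathbb C[t]$, $M_p$ is multiplication by $p$. For $k\in\mathcal M$, $(V_kf)(t)=\int_0^tk(t-s)f(s)\,ds$. Let $\Delta_T=\{(t,s):0\le s\le t\le T\}$ and, for a bivariate kernel $K$ on $\Delta_T$, $(V_Kf)(t)=\int_0^tK(t,s)f(s)\,ds$. Put $$\mathcal K_{\mathrm{flat}}=\Big\{K(t,s)=\sum_{r=1}^{N}p_r(t)k_r(t-s):\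 p_r\in\mathbb C[t],\ k_r\in\mathcal M,\ N<\infty\Big\}.$$ $\mathcal A_\Gamma$ is the subalgebra of $\operatorname{End}_{\mathbb C}(\mathcal M)$ generated by $\{M_p:p\in\mathbb C[t]\}$, $\{D^\gamma:\gamma\in\Gamma\}$ and $\{V_k:k\in\mathcal M\}$. *)

theory Defs
  imports "HOL-Analysis.Analysis" "HOL-Computational_Algebra.Polynomial" "HOL-Library.FuncSet"
begin

(* A function on [0,T] is encoded as a total function on the reals that vanishes outside
   [0,T], and a kernel on the triangle as one that vanishes outside the triangle, so that
   HOL equality is equality on the actual domain. *)

definition deriv_on :: "real \<Rightarrow> (real \<Rightarrow> complex) \<Rightarrow> real \<Rightarrow> complex" where
  "deriv_on T f t = (if t \<in> {0..T} then vector_derivative f (at t within {0..T}) else 0)"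

definition nderiv :: "real \<Rightarrow> nat \<Rightarrow> (real \<Rightarrow> complex) \<Rightarrow> real \<Rightarrow> complex" where
  "nderiv T n = deriv_on T ^^ n"

definition flat_space :: "real \<Rightarrow> (real \<Rightarrow> complex) set" where
  "flat_space T = {f. (\<forall>t. t \<notin> {0..T} \<longrightarrow> f t = 0)
     \<and> (\<forall>n. nderiv T n f differentiable_on {0..T})
     \<and> (\<forall>n. nderiv T n f 0 = 0)}"

definition frac_int :: "real \<Rightarrow> real \<Rightarrow> (real \<Rightarrow> complex) \<Rightarrow> real \<Rightarrow> complex" where
  "frac_int T \<mu> f t = (if t \<in> {0..T}
     then (1 / Gamma \<mu>) *\<^sub>R integral {0..t} (\<lambda>s. ((t - s) powr (\<mu> - 1)) *\<^sub>R f s)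
     else 0)"

(* For \<alpha> > 0, J^(n-\<alpha>) f^(n) is the same for every integer n > \<alpha> when f is in flat_space T;
   the definition takes the least such n. *)
definition frac_deriv :: "real \<Rightarrow> real \<Rightarrow> (real \<Rightarrow> complex) \<Rightarrow> real \<Rightarrow> complex" where
  "frac_deriv T \<alpha> f =
     (if \<alpha> < 0 then frac_int T (- \<alpha>) f
      else if \<alpha> = 0 then f
      else (let n = (LEAST n::nat. \<alpha> < real n) in frac_int T (real n - \<alpha>) (nderiv T n f)))"

definition mult_op :: "complex poly \<Rightarrow> (real \<Rightarrow> complex) \<Rightarrow> real \<Rightarrow> complex" where
  "mult_op p f t = poly p (of_real t) * f t"

definition conv_op ::
    "real \<Rightarrow> (real \<Rightarrow> complex) \<Rightarrow> (real \<Rightarrow> complex) \<Rightarrow> real \<Rightarrow> complex" where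
  "conv_op T k f t = (if t \<in> {0..T} then integral {0..t} (\<lambda>s. k (t - s) * f s) else 0)"

definition volterra_op ::
    "real \<Rightarrow> (real \<times> real \<Rightarrow> complex) \<Rightarrow> (real \<Rightarrow> complex) \<Rightarrow> real \<Rightarrow> complex" where
  "volterra_op T K f t = (if t \<in> {0..T} then integral {0..t} (\<lambda>s. K (t, s) * f s) else 0)"

definition triangle :: "real \<Rightarrow> (real \<times> real) set" where
  "triangle T = {(t, s). 0 \<le> s \<and> s \<le> t \<and> t \<le> T}"

definition flat_kernels :: "real \<Rightarrow> (real \<times> real \<Rightarrow> complex) set" where
  "flat_kernels T = {K. \<exists>(N::nat) p k. (\<forall>r\<in>{1..N}. k r \<in> flat_space T)
     \<and> (\<forall>t s. K (t, s) =
          (if (t, s) \<in> triangle T then \<Sum>r=1..N. poly (p r) (of_real t) * k r (t - s) else 0))}"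

(* Endomorphisms are extensional on flat_space T, so that their HOL equality is agreement
   on flat_space T. *)
definition flat_End :: "real \<Rightarrow> ((real \<Rightarrow> complex) \<Rightarrow> (real \<Rightarrow> complex)) set" where
  "flat_End T = {A. A \<in> flat_space T \<rightarrow>\<^sub>E flat_space T
     \<and> (\<forall>f\<in>flat_space T. \<forall>g\<in>flat_space T. A (\<lambda>t. f t + g t) = (\<lambda>t. A f t + A g t))
     \<and> (\<forall>c. \<forall>f\<in>flat_space T. A (\<lambda>t. c * f t) = (\<lambda>t. c * A f t))}"

definition flat_subalgebra :: "real \<Rightarrow> ((real \<Rightarrow> complex) \<Rightarrow> (real \<Rightarrow> complex)) set \<Rightarrow> bool" where
  "flat_subalgebra T B \<longleftrightarrow> B \<subseteq> flat_End T
     \<and> (\<lambda>f\<in>flat_space T. f) \<in> B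
     \<and> (\<forall>A\<in>B. \<forall>A'\<in>B. (\<lambda>f\<in>flat_space T. \<lambda>t. A f t + A' f t) \<in> B)
     \<and> (\<forall>c. \<forall>A\<in>B. (\<lambda>f\<in>flat_space T. \<lambda>t. c * A f t) \<in> B)
     \<and> (\<forall>A\<in>B. \<forall>A'\<in>B. (\<lambda>f\<in>flat_space T. A (A' f)) \<in> B)"

definition frac_algebra :: "real \<Rightarrow> real set \<Rightarrow> ((real \<Rightarrow> complex) \<Rightarrow> (real \<Rightarrow> complex)) set" where
  "frac_algebra T \<Gamma> = flat_subalgebra T hull
     ((\<lambda>p. restrict (mult_op p) (flat_space T)) ` UNIV
      \<union> (\<lambda>\<gamma>. restrict (frac_deriv T \<gamma>) (flat_space T)) ` \<Gamma>
      \<union> (\<lambda>k. restrict (conv_op T k) (flat_space T)) ` flat_space T)"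

definition is_representation ::
    "real \<Rightarrow> real set \<Rightarrow> ((real \<Rightarrow> complex) \<Rightarrow> (real \<Rightarrow> complex)) \<Rightarrow>
     real set \<Rightarrow> (real \<Rightarrow> complex poly) \<Rightarrow> (real \<times> real \<Rightarrow> complex) \<Rightarrow> bool" where
  "is_representation T \<Gamma> A F p K \<longleftrightarrow> finite F \<and> F \<subseteq> \<Gamma> \<and> K \<in> flat_kernels T
     \<and> A = (\<lambda>f\<in>flat_space T. \<lambda>t.
              (\<Sum>\<gamma>\<in>F. mult_op (p \<gamma>) (frac_deriv T \<gamma> f) t) + volterra_op T K f t)"

end

theory Submission
  imports Defs
begin

text \<open>
  Write \<open>M\<close> for \<open>flat_space T\<close>. Up to the polynomial coefficients on
  the left, every operator in sight is a convolution \<open>k * f\<close> with an integrable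
  kernel \<open>k\<close> on \<open>[0, \<infinity>)\<close>, possibly composed with
  derivatives: \<open>J\<^sup>\<mu>\<close> has the kernel \<open>u powr (\<mu> - 1) /
  \<Gamma>(\<mu>)\<close>. Convolution with an integrable kernel preserves \<open>M\<close>
  and commutes with \<open>d/dt\<close> there, because \<open>f = 1 * f'\<close> on
  \<open>M\<close> and hence \<open>k * f = 1 * (k * f')\<close>
  (\<open>conv_op_has_deriv\<close>). With the Beta integral
  (\<open>frac_int_compose\<close>), the calculus of the \<open>D\<^sup>\<alpha>\<close> is
  then the associativity and commutativity of convolution.

  Existence. The rules \<open>D\<^sup>\<gamma> t = t D\<^sup>\<gamma> + \<gamma>
  D\<^bsup>\<gamma> - 1\<^esup>\<close> and \<open>V\<^sub>k t = t V\<^sub>k -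
  V\<^bsub>tk\<^esub>\<close> move polynomials to the left, and \<open>D\<^sup>\<gamma>
  V\<^sub>k = V\<^sub>k D\<^sup>\<gamma> = V\<^bsub>D\<^sup>\<gamma>k\<^esub>\<close>,
  \<open>V\<^sub>k V\<^sub>l = V\<^bsub>k * l\<^esub>\<close> multiply what is left over. So
  the span of the operators \<open>M\<^sub>p D\<^sup>\<gamma>\<close> and \<open>M\<^sub>p
  V\<^sub>k\<close> is closed under composition (\<open>representable_compose\<close>). It is
  a subalgebra with the given generators, hence contains the algebra that they generate
  (\<open>frac_algebra_representable\<close>).

  Uniqueness. Suppose \<open>\<Sum> M\<^sub>p\<^sub>\<gamma> D\<^sup>\<gamma> + V\<^sub>K =
  0\<close> on \<open>M\<close>, and compose with \<open>D\<^bsup>-m\<^esup>\<close> for a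
  large integer \<open>m\<close>. All orders become negative, so at a fixed \<open>t\<close>
  the operator is the integral of \<open>g(s)\<close> against a continuous function of
  \<open>u = t - s\<close>, namely \<open>\<Sum> p\<^sub>\<gamma>(t) u powr (m - \<gamma> - 1)
  / \<Gamma>(m - \<gamma>) + h(u)\<close> with \<open>h \<in> M\<close>. As \<open>M\<close>
  contains all products of \<open>exp (-1/s)\<close> with polynomials, Weierstrass' theorem
  shows that this function vanishes (\<open>orthogonal_to_flat_space_eq_0\<close>). Near
  \<open>u = 0\<close> the function \<open>h\<close> is smaller than every power, so comparing
  orders of growth gives \<open>p\<^sub>\<gamma>(t) = 0\<close> for each
  \<open>\<gamma>\<close> (\<open>powers_independent_mod_flat\<close>). What remains is
  \<open>V\<^sub>K = 0\<close>, and the same orthogonality gives \<open>K = 0\<close>.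
\<close>

section \<open>Smooth functions that are flat at zero\<close>

lemma nderiv_0 [simp]: "nderiv T 0 f = f"
  by (simp add: nderiv_def)

lemma nderiv_Suc: "nderiv T (Suc n) f = nderiv T n (deriv_on T f)"
  by (simp add: nderiv_def funpow_Suc_right del: funpow.simps)

lemma nderiv_Suc': "nderiv T (Suc n) f = deriv_on T (nderiv T n f)"
  by (simp add: nderiv_def)

lemma nderiv_add: "nderiv T (m + n) f = nderiv T m (nderiv T n f)"
  by (simp add: nderiv_def funpow_add)

lemma deriv_on_eqI:
  assumes "T > 0" "\<And>t. t \<in> {0..T} \<Longrightarrow> (f has_vector_derivative f' t) (at t within {0..T})"
    and "\<And>t. t \<notin> {0..T} \<Longrightarrow> f' t = 0"
  shows "deriv_on T f = f'"
proof
  show "deriv_on T f t = f' t" for t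
    using assms vector_derivative_within_cbox[of 0 T t f "f' t"] by (auto simp: deriv_on_def)
qed

text \<open>The derivative is unique on \<open>{0..T}\<close>, so a set of functions vanishing
  at \<open>0\<close> that contains a derivative of each of its members contains all iterated
  derivatives. This replaces inductions on the order of the derivative in the closure properties
  below.\<close>

lemma flat_space_coinduct:
  assumes T: "T > 0" and "f \<in> S"
    and out: "\<And>g t. g \<in> S \<Longrightarrow> t \<notin> {0..T} \<Longrightarrow> g t = 0"
    and zero: "\<And>g. g \<in> S \<Longrightarrow> g 0 = 0"
    and der: "\<And>g. g \<in> S \<Longrightarrow> \<exists>g'\<in>S. \<forall>t\<in>{0..T}. (g has_vector_derivative g' t) (at t within {0..T})"
  shows "f \<in> flat_space T"
proof -
  have D: "deriv_on T g \<in> S" if "g \<in> S" for g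
    using der[OF that] deriv_on_eqI[OF T] out by (metis)
  have N: "nderiv T n f \<in> S" for n
    by (induction n) (use D \<open>f \<in> S\<close> in \<open>auto simp: nderiv_Suc'\<close>)
  have "g differentiable_on {0..T}" if "g \<in> S" for g
    using der[OF that] unfolding differentiable_on_def
    by (meson differentiableI_vector)
  then show ?thesis
    using N out zero \<open>f \<in> S\<close> by (auto simp: flat_space_def)
qed

lemma flat_space_outside: "f \<in> flat_space T \<Longrightarrow> t \<notin> {0..T} \<Longrightarrow> f t = 0"
  by (auto simp: flat_space_def)

lemma flat_space_at_0: "f \<in> flat_space T \<Longrightarrow> f 0 = 0"
  unfolding flat_space_def by (metis (mono_tags, lifting) mem_Collect_eq nderiv_0)

lemma flat_space_has_deriv:
  assumes "f \<in> flat_space T" "t \<in> {0..T}"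
  shows "(f has_vector_derivative deriv_on T f t) (at t within {0..T})"
proof -
  have "f differentiable_on {0..T}"
    using assms unfolding flat_space_def by (metis (mono_tags, lifting) mem_Collect_eq nderiv_0)
  then show ?thesis
    using assms by (auto simp: deriv_on_def differentiable_on_def vector_derivative_works)
qed

lemma flat_space_deriv_on: "f \<in> flat_space T \<Longrightarrow> deriv_on T f \<in> flat_space T"
  unfolding flat_space_def mem_Collect_eq
  by (metis deriv_on_def nderiv_Suc)

lemma flat_space_nderiv: "f \<in> flat_space T \<Longrightarrow> nderiv T n f \<in> flat_space T"
  by (induction n) (auto simp: nderiv_Suc' flat_space_deriv_on)

lemma flat_space_continuous_on: "f \<in> flat_space T \<Longrightarrow> continuous_on {0..T} f"
  by (meson continuous_on_vector_derivative flat_space_has_deriv)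

lemma flat_space_zero: "T > 0 \<Longrightarrow> (\<lambda>t. 0) \<in> flat_space T"
  by (rule flat_space_coinduct[where S="{\<lambda>t. 0}"]) auto

lemma flat_space_add:
  assumes "T > 0" "f \<in> flat_space T" "g \<in> flat_space T"
  shows "(\<lambda>t. f t + g t) \<in> flat_space T"
proof (rule flat_space_coinduct[where S="(\<lambda>(f, g). \<lambda>t. f t + g t) ` (flat_space T \<times> flat_space T)"])
  fix h assume "h \<in> (\<lambda>(f, g). \<lambda>t. f t + g t) ` (flat_space T \<times> flat_space T)"
  then obtain f g where h: "h = (\<lambda>t. f t + g t)" and f: "f \<in> flat_space T" and g: "g \<in> flat_space T"
    by auto
  show "\<exists>h'\<in>(\<lambda>(f, g). \<lambda>t. f t + g t) ` (flat_space T \<times> flat_space T).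
      \<forall>t\<in>{0..T}. (h has_vector_derivative h' t) (at t within {0..T})"
    unfolding h
    by (intro bexI[of _ "\<lambda>t. deriv_on T f t + deriv_on T g t"] ballI has_vector_derivative_add
        flat_space_has_deriv image_eqI[of _ _ "(deriv_on T f, deriv_on T g)"])
      (use f g in \<open>auto intro: flat_space_deriv_on\<close>)
qed (use assms in \<open>auto simp: flat_space_outside flat_space_at_0\<close>)

lemma flat_space_cmult:
  assumes "T > 0" "f \<in> flat_space T"
  shows "(\<lambda>t. c * f t) \<in> flat_space T"
proof (rule flat_space_coinduct[where S="(\<lambda>f. \<lambda>t. c * f t) ` flat_space T"])
  fix h assume "h \<in> (\<lambda>f. \<lambda>t. c * f t) ` flat_space T"
  then obtain f where h: "h = (\<lambda>t. c * f t)" and f: "f \<in> flat_space T"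
    by auto
  show "\<exists>h'\<in>(\<lambda>f. \<lambda>t. c * f t) ` flat_space T.
      \<forall>t\<in>{0..T}. (h has_vector_derivative h' t) (at t within {0..T})"
    unfolding h
    by (intro bexI[of _ "\<lambda>t. c * deriv_on T f t"] ballI has_vector_derivative_mult_right
        flat_space_has_deriv image_eqI[of _ _ "deriv_on T f"])
      (use f in \<open>auto intro: flat_space_deriv_on\<close>)
qed (use assms in \<open>auto simp: flat_space_outside flat_space_at_0\<close>)

lemma deriv_on_tmult:
  assumes "f \<in> flat_space T" "t \<in> {0..T}"
  shows "((\<lambda>t. of_real t * f t) has_vector_derivative of_real t * deriv_on T f t + f t) (at t within {0..T})"
proof -
  have "((\<lambda>t. complex_of_real t) has_vector_derivative 1) (at t within {0..T})"
    using has_vector_derivative_of_real[OF DERIV_ident] by fastforce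
  from has_vector_derivative_mult[OF this flat_space_has_deriv[OF assms]] show ?thesis by simp
qed

lemma flat_space_tmult:
  assumes T: "T > 0" and "f \<in> flat_space T"
  shows "(\<lambda>t. of_real t * f t) \<in> flat_space T"
\<comment> \<open>The products \<open>t f\<close> alone are not closed under differentiation, since \<open>(t f)' = t f' + f\<close>.\<close>
proof (rule flat_space_coinduct[where S="{\<lambda>t. of_real t * f t + g t | f g. f \<in> flat_space T \<and> g \<in> flat_space T}"])
  show "(\<lambda>t. of_real t * f t) \<in> {\<lambda>t. of_real t * f t + g t | f g. f \<in> flat_space T \<and> g \<in> flat_space T}"
    using assms flat_space_zero by force
  fix h assume "h \<in> {\<lambda>t. of_real t * f t + g t | f g. f \<in> flat_space T \<and> g \<in> flat_space T}"
  then obtain f g where h: "h = (\<lambda>t. of_real t * f t + g t)" and f: "f \<in> flat_space T" and g: "g \<in> flat_space T"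
    by blast
  let ?h' = "\<lambda>t. of_real t * deriv_on T f t + (f t + deriv_on T g t)"
  have "(h has_vector_derivative ?h' t) (at t within {0..T})" if "t \<in> {0..T}" for t
    using has_vector_derivative_add[OF deriv_on_tmult[OF f that] flat_space_has_deriv[OF g that]]
    by (simp add: h add.assoc)
  moreover have "deriv_on T f \<in> flat_space T" "(\<lambda>t. f t + deriv_on T g t) \<in> flat_space T"
    using f g T by (auto intro: flat_space_deriv_on flat_space_add)
  ultimately show "\<exists>g'\<in>{\<lambda>t. of_real t * f t + g t | f g. f \<in> flat_space T \<and> g \<in> flat_space T}.
      \<forall>t\<in>{0..T}. (h has_vector_derivative g' t) (at t within {0..T})"
    by (intro bexI[of _ ?h']) auto
qed (auto simp: flat_space_outside flat_space_at_0 T)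

lemma mult_op_pCons:
  "mult_op (pCons a p) f = (\<lambda>t. a * f t + of_real t * mult_op p f t)"
  by (auto simp: mult_op_def fun_eq_iff algebra_simps)

lemma flat_space_mult_op:
  assumes "T > 0" "f \<in> flat_space T"
  shows "mult_op p f \<in> flat_space T"
proof (induction p)
  case 0
  then show ?case using flat_space_zero[OF assms(1)] by (simp add: mult_op_def[abs_def])
next
  case (pCons a p)
  then show ?case
    unfolding mult_op_pCons using assms flat_space_add flat_space_cmult flat_space_tmult by presburger
qed

lemma flat_space_sum:
  assumes "T > 0" "\<And>i. i \<in> I \<Longrightarrow> f i \<in> flat_space T"
  shows "(\<lambda>t. \<Sum>i\<in>I. f i t) \<in> flat_space T"
  using assms(2)
  by (induction I rule: infinite_finite_induct)
    (auto simp: flat_space_zero flat_space_add assms(1))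

text \<open>Integrating a bound \<open>C u^n\<close> for the derivative, which lies in the space
  again, gains a power of \<open>u\<close>: flat functions are smaller than every power at
  \<open>0\<close>.\<close>

lemma flat_space_bound:
  assumes "T > 0"
  shows "f \<in> flat_space T \<Longrightarrow> \<exists>C. \<forall>u\<in>{0..T}. norm (f u) \<le> C * u ^ n"
proof (induction n arbitrary: f)
  case 0
  then have "compact (f ` {0..T})"
    using compact_continuous_image flat_space_continuous_on by blast
  then have "bounded (f ` {0..T})" by (rule compact_imp_bounded)
  then show ?case by (auto simp: bounded_iff)
next
  case (Suc n)
  obtain C where C: "\<And>u. u \<in> {0..T} \<Longrightarrow> norm (deriv_on T f u) \<le> C * u ^ n"
    using Suc.IH flat_space_deriv_on[OF Suc.prems] by blast
  then have "0 \<le> C * T ^ n" by (metis assms atLeastAtMost_iff less_eq_real_def norm_ge_zero order_trans)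
  then have C0: "C \<ge> 0" using assms by (smt (verit) mult_neg_pos zero_less_power)
  have "norm (f u) \<le> C * u ^ Suc n" if u: "u \<in> {0..T}" for u
  proof -
    have "norm (f u - f 0) \<le> (C * u ^ n) * norm (u - 0)"
    proof (rule differentiable_bound[of "{0..u}" f "\<lambda>s h. h *\<^sub>R deriv_on T f s"])
      fix s assume s: "s \<in> {0..u}"
      then have "(f has_vector_derivative deriv_on T f s) (at s within {0..T})"
        using u Suc.prems by (intro flat_space_has_deriv) auto
      then show "(f has_derivative (\<lambda>h. h *\<^sub>R deriv_on T f s)) (at s within {0..u})"
        using u unfolding has_vector_derivative_def
        by (elim has_derivative_subset) auto
      have "norm (deriv_on T f s) \<le> C * s ^ n" using C s u by auto
      also have "\<dots> \<le> C * u ^ n"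
        using s C0 by (intro mult_left_mono power_mono) auto
      finally show "onorm (\<lambda>h. h *\<^sub>R deriv_on T f s) \<le> C * u ^ n"
        by (intro onorm_le) (metis mult.commute mult_left_mono norm_ge_zero norm_scaleR real_norm_def)
    qed (use u in auto)
    then show ?thesis using flat_space_at_0[OF Suc.prems] u by (simp add: algebra_simps)
  qed
  then show ?case by blast
qed

section \<open>Convolution with integrable causal kernels\<close>

text \<open>Kernels need only be integrable, so that the singular kernel of
  \<open>J\<^sup>\<mu>\<close> with \<open>\<mu> < 1\<close> is included. The functions they act
  on are bounded: then the convolution integral converges at every point, and the identities
  below hold pointwise rather than almost everywhere.\<close>

definition causal_kernels :: "(real \<Rightarrow> complex) set" where
  "causal_kernels = {k. integrable lborel k \<and> (\<forall>u<0. k u = 0)}"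

definition bounded_causal :: "(real \<Rightarrow> complex) set" where
  "bounded_causal = {f. f \<in> borel_measurable lborel \<and> (\<exists>B. \<forall>s. norm (f s) \<le> B) \<and> (\<forall>s<0. f s = 0)}"

text \<open>For causal arguments this is the integral over \<open>{0..t}\<close>; integrating
  over the whole line makes the substitutions \<open>s \<mapsto> t - s\<close> and Fubini's
  theorem available without moving limits.\<close>

definition convolution :: "(real \<Rightarrow> complex) \<Rightarrow> (real \<Rightarrow> complex) \<Rightarrow> real \<Rightarrow> complex" where
  "convolution k f t = (LINT s|lborel. k (t - s) * f s)"

lemma integrable_reflect:
  fixes k :: "real \<Rightarrow> complex"
  assumes "integrable lborel k" shows "integrable lborel (\<lambda>s. k (t - s))"
  using lborel_integrable_real_affine[OF assms, of "-1" t] by simp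

lemma integral_reflect:
  fixes k :: "real \<Rightarrow> 'a :: euclidean_space"
  shows "(LINT s|lborel. k (t - s)) = (LINT s|lborel. k s)"
  using lborel_integral_real_affine[of "-1" k t] by simp

lemma convolution_commute: "convolution k f t = convolution f k t"
  unfolding convolution_def
  using integral_reflect[of "\<lambda>s. k (t - s) * f s" t] by (simp add: mult.commute)

lemma integrable_mult_bounded:
  fixes k f :: "real \<Rightarrow> complex"
  assumes "integrable lborel k" "f \<in> borel_measurable lborel" "\<And>s. norm (f s) \<le> B"
  shows "integrable lborel (\<lambda>s. k s * f s)"
proof (rule Bochner_Integration.integrable_bound[of _ "\<lambda>s. norm (k s) * B"])
  show "integrable lborel (\<lambda>s. norm (k s) * B)" using assms(1) by simp
  show "(\<lambda>s. k s * f s) \<in> borel_measurable lborel" using assms(1,2) by measurable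
  show "AE x in lborel. norm (k x * f x) \<le> norm (norm (k x) * B)"
    using assms(3) by (intro AE_I2) (simp add: norm_mult abs_mult mult_left_mono order_trans[OF _ abs_ge_self])
qed

lemma integrable_convolution_integrand:
  assumes "k \<in> causal_kernels" "f \<in> bounded_causal"
  shows "integrable lborel (\<lambda>s. k (t - s) * f s)"
  using assms integrable_mult_bounded[OF integrable_reflect]
  unfolding causal_kernels_def bounded_causal_def by blast

lemma convolution_causal:
  assumes "\<And>u. u < 0 \<Longrightarrow> k u = 0" "\<And>s. s < 0 \<Longrightarrow> f s = 0" "t < 0"
  shows "convolution k f t = 0"
proof -
  have "(\<lambda>s. k (t - s) * f s) = (\<lambda>s. 0)"
  proof
    show "k (t - s) * f s = 0" for s
      using assms by (cases "s < 0") auto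
  qed
  then show ?thesis by (simp add: convolution_def)
qed

lemma convolution_bounded_causal:
  assumes k: "k \<in> causal_kernels" and f: "f \<in> bounded_causal"
  shows "convolution k f \<in> bounded_causal"
proof -
  have [measurable]: "k \<in> borel_measurable borel" "f \<in> borel_measurable borel"
    using k f by (auto simp: causal_kernels_def bounded_causal_def)
  obtain B where B: "\<And>s. norm (f s) \<le> B" using f by (auto simp: bounded_causal_def)
  have "convolution k f \<in> borel_measurable lborel"
    unfolding convolution_def by measurable
  moreover have "norm (convolution k f t) \<le> (LINT s|lborel. norm (k s)) * B" for t
  proof -
    have "integrable lborel (\<lambda>s. norm (k (t - s)) * B)"
      using k integrable_reflect[of k t] by (simp add: causal_kernels_def)
    then have "norm (convolution k f t) \<le> (LINT s|lborel. norm (k (t - s)) * B)"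
      unfolding convolution_def using B
      by (intro Bochner_Integration.integral_norm_bound_integral integrable_convolution_integrand k f)
        (auto simp: norm_mult mult_left_mono)
    then show ?thesis using integral_reflect[of "\<lambda>s. norm (k s)" t] by simp
  qed
  moreover have "convolution k f t = 0" if "t < 0" for t
    using k f that by (intro convolution_causal) (auto simp: causal_kernels_def bounded_causal_def)
  ultimately show ?thesis unfolding bounded_causal_def by blast
qed

text \<open>Fubini's theorem for \<open>k(t - u) l(u - s) f(s)\<close>, which is integrable
  because its absolute value has the iterated integral at most \<open>sup |f|\<close> times the
  norms of \<open>k\<close> and \<open>l\<close>. The second claim, also a consequence of
  Fubini, is needed because \<open>convolution k l\<close> itself may be unbounded.\<close>

lemma convolution_assoc:
  assumes k: "k \<in> causal_kernels" and l: "l \<in> causal_kernels" and f: "f \<in> bounded_causal"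
  shows "convolution k (convolution l f) t = convolution (convolution k l) f t"
    and "integrable lborel (\<lambda>s. convolution k l (t - s) * f s)"
proof -
  have [measurable]: "k \<in> borel_measurable borel" "l \<in> borel_measurable borel" "f \<in> borel_measurable borel"
    using k l f by (auto simp: causal_kernels_def bounded_causal_def)
  have [measurable]: "integrable lborel k" "integrable lborel l"
    using k l by (auto simp: causal_kernels_def)
  obtain B where B: "\<And>s. norm (f s) \<le> B" using f by (auto simp: bounded_causal_def)
  let ?F = "\<lambda>u s. k (t - u) * (l (u - s) * f s)"
  have inner: "integrable lborel (\<lambda>s. l (u - s) * f s)" for u
    using integrable_convolution_integrand[OF l f] .
  have F: "integrable (lborel \<Otimes>\<^sub>M lborel) (case_prod ?F)"
  proof (rule lborel_pair.Fubini_integrable)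
    show "(\<lambda>(u, s). ?F u s) \<in> borel_measurable (lborel \<Otimes>\<^sub>M lborel)" by measurable
    show "AE u in lborel. integrable lborel (\<lambda>s. case (u, s) of (u, s) \<Rightarrow> ?F u s)"
      using inner by (intro AE_I2) simp
    have bnd: "(LINT s|lborel. norm (l (u - s) * f s)) \<le> (LINT s|lborel. norm (l s)) * B" for u
    proof -
      have "(LINT s|lborel. norm (l (u - s) * f s)) \<le> (LINT s|lborel. norm (l (u - s)) * B)"
        using B l integrable_reflect[of l u] integrable_norm[OF inner[of u]]
        by (intro integral_mono) (auto simp: causal_kernels_def norm_mult intro: mult_left_mono)
      then show ?thesis using integral_reflect[of "\<lambda>s. norm (l s)" u] by simp
    qed
    show "integrable lborel (\<lambda>u. LINT s|lborel. norm (case (u, s) of (u, s) \<Rightarrow> ?F u s))"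
    proof (rule Bochner_Integration.integrable_bound
          [of _ "\<lambda>u. norm (k (t - u)) * ((LINT s|lborel. norm (l s)) * B)"])
      show "integrable lborel (\<lambda>u. norm (k (t - u)) * ((LINT s|lborel. norm (l s)) * B))"
        using k integrable_reflect by (auto simp: causal_kernels_def)
      show "AE u in lborel. norm (LINT s|lborel. norm (case (u, s) of (u, s) \<Rightarrow> ?F u s))
          \<le> norm (norm (k (t - u)) * ((LINT s|lborel. norm (l s)) * B))"
      proof (intro AE_I2)
        fix u
        have eq: "(LINT s|lborel. norm (case (u, s) of (u, s) \<Rightarrow> ?F u s))
            = norm (k (t - u)) * (LINT s|lborel. norm (l (u - s) * f s))"
          by (simp add: norm_mult)
        have "0 \<le> norm (k (t - u)) * (LINT s|lborel. norm (l (u - s) * f s))"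
          by simp
        moreover have "\<dots> \<le> norm (k (t - u)) * ((LINT s|lborel. norm (l s)) * B)"
          by (intro mult_left_mono bnd) auto
        ultimately show "norm (LINT s|lborel. norm (case (u, s) of (u, s) \<Rightarrow> ?F u s))
          \<le> norm (norm (k (t - u)) * ((LINT s|lborel. norm (l s)) * B))"
          unfolding eq real_norm_def by linarith
      qed
    qed measurable
  qed
  \<comment> \<open>The inner integral over \<open>u\<close> becomes a convolution after the shift \<open>u = s + v\<close>.\<close>
  have collapse: "(LINT u|lborel. ?F u s) = convolution k l (t - s) * f s" for s
  proof -
    have "(LINT u|lborel. ?F u s) = (LINT u|lborel. k (t - u) * l (u - s)) * f s"
      by (simp add: mult.assoc[symmetric])
    also have "(LINT u|lborel. k (t - u) * l (u - s)) = (LINT v|lborel. k (t - s - v) * l v)"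
      using lborel_integral_real_affine[of 1 "\<lambda>u. k (t - u) * l (u - s)" s]
      by (simp add: algebra_simps)
    finally show ?thesis by (simp add: convolution_def)
  qed
  have "convolution k (convolution l f) t = (LINT u|lborel. LINT s|lborel. ?F u s)"
    by (simp add: convolution_def)
  also have "\<dots> = (LINT s|lborel. LINT u|lborel. ?F u s)"
    using lborel_pair.Fubini_integral[OF F] by simp
  finally show "convolution k (convolution l f) t = convolution (convolution k l) f t"
    unfolding collapse by (simp add: convolution_def)
  show "integrable lborel (\<lambda>s. convolution k l (t - s) * f s)"
    using lborel_pair.integrable_snd[OF F] unfolding collapse .
qed

lemma flat_space_causal:
  assumes "T > 0" "f \<in> flat_space T"
  shows "f \<in> causal_kernels" "f \<in> bounded_causal"
proof -
  have "set_integrable lborel {0..T} f"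
    by (intro borel_integrable_atLeastAtMost' flat_space_continuous_on assms)
  moreover have "(\<lambda>x. indicator {0..T} x *\<^sub>R f x) = f"
    using flat_space_outside[OF assms(2)] by (auto simp: indicator_def fun_eq_iff)
  ultimately have int: "integrable lborel f" by (simp add: set_integrable_def)
  then show "f \<in> causal_kernels"
    using flat_space_outside[OF assms(2)] by (auto simp: causal_kernels_def)
  obtain C where C: "\<And>u. u \<in> {0..T} \<Longrightarrow> norm (f u) \<le> C * u ^ 0"
    using flat_space_bound[OF assms, of 0] by blast
  have "norm (f u) \<le> C" for u
    using C[of u] C[of 0] flat_space_outside[OF assms(2), of u] assms(1)
    by (cases "u \<in> {0..T}") (auto intro: order_trans[OF norm_ge_zero])
  with int show "f \<in> bounded_causal"
    using flat_space_outside[OF assms(2)] by (auto simp: bounded_causal_def)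
qed

lemma integral_eq_convolution:
  assumes "integrable lborel (\<lambda>s. k (t - s) * f s)"
    and "\<And>u. u < 0 \<Longrightarrow> k u = 0" "\<And>s. s < 0 \<Longrightarrow> f s = 0"
  shows "((\<lambda>s. k (t - s) * f s) has_integral convolution k f t) {0..t}"
proof -
  have eq: "(\<lambda>s. indicator {0..t} s *\<^sub>R (k (t - s) * f s)) = (\<lambda>s. k (t - s) * f s)"
    using assms(2,3) by (fastforce simp: indicator_def)
  have "set_integrable lborel {0..t} (\<lambda>s. k (t - s) * f s)"
    unfolding set_integrable_def eq by (rule assms(1))
  from set_borel_integral_eq_integral[OF this] show ?thesis
    by (simp add: has_integral_iff set_lebesgue_integral_def eq convolution_def)
qed

lemma conv_op_eq_convolution:
  assumes "k \<in> causal_kernels" "f \<in> bounded_causal" "t \<in> {0..T}"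
  shows "conv_op T k f t = convolution k f t"
proof -
  have "((\<lambda>s. k (t - s) * f s) has_integral convolution k f t) {0..t}"
    using assms by (intro integral_eq_convolution integrable_convolution_integrand)
      (auto simp: causal_kernels_def bounded_causal_def)
  then show ?thesis using assms(3) by (auto simp: conv_op_def)
qed

lemma conv_op_integrable:
  assumes "k \<in> causal_kernels" "f \<in> bounded_causal"
  shows "(\<lambda>s. k (t - s) * f s) integrable_on {0..t}"
proof (rule has_integral_integrable[OF integral_eq_convolution])
  show "integrable lborel (\<lambda>s. k (t - s) * f s)"
    using assms by (rule integrable_convolution_integrand)
qed (use assms in \<open>auto simp: causal_kernels_def bounded_causal_def\<close>)

lemma conv_op_outside: "t \<notin> {0..T} \<Longrightarrow> conv_op T k f t = 0"
  unfolding conv_op_def by (simp only: if_False)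

lemma conv_op_cong:
  assumes "\<And>s. s \<in> {0..T} \<Longrightarrow> k s = k' s" "\<And>s. s \<in> {0..T} \<Longrightarrow> f s = f' s"
  shows "conv_op T k f = conv_op T k' f'"
proof
  show "conv_op T k f t = conv_op T k' f' t" for t
  proof (cases "t \<in> {0..T}")
    case True
    then have "integral {0..t} (\<lambda>s. k (t - s) * f s) = integral {0..t} (\<lambda>s. k' (t - s) * f' s)"
      using assms by (intro integral_cong) auto
    then show ?thesis by (simp add: conv_op_def)
  qed (auto simp: conv_op_def)
qed

text \<open>At \<open>t \<in> {0..T}\<close> a causal convolution involves only the values of
  its arguments on \<open>{0..t}\<close>, so cutting off at \<open>T\<close> is harmless, and
  \<open>convolution k l\<close> may be replaced by any function \<open>m\<close> that agrees
  with it on \<open>{0..T}\<close>.\<close>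

lemma conv_op_assoc:
  assumes k: "k \<in> causal_kernels" and l: "l \<in> causal_kernels" and f: "f \<in> bounded_causal"
    and kl: "\<And>t. t \<in> {0..T} \<Longrightarrow> m t = convolution k l t"
  shows "conv_op T k (conv_op T l f) = conv_op T m f"
proof
  fix t show "conv_op T k (conv_op T l f) t = conv_op T m f t"
  proof (cases "t \<in> {0..T}")
    case t: True
    have "conv_op T k (conv_op T l f) t = conv_op T k (convolution l f) t"
      using conv_op_cong[of T k k "conv_op T l f" "convolution l f"] conv_op_eq_convolution[OF l f]
      by simp
    also have "\<dots> = convolution k (convolution l f) t"
      by (rule conv_op_eq_convolution[OF k convolution_bounded_causal[OF l f] t])
    also have "\<dots> = convolution (convolution k l) f t"
      by (rule convolution_assoc[OF k l f])
    also have "\<dots> = integral {0..t} (\<lambda>s. convolution k l (t - s) * f s)"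
      using k l f convolution_assoc(2)[OF k l f]
      by (intro integral_unique[symmetric] integral_eq_convolution)
        (auto simp: causal_kernels_def bounded_causal_def convolution_causal)
    also have "\<dots> = conv_op T m f t"
      using t kl fun_cong[OF conv_op_cong[of T "convolution k l" m f f], of t] by (simp add: conv_op_def)
    finally show ?thesis .
  qed (auto simp: conv_op_def)
qed

section \<open>Fractional integrals as convolutions\<close>

text \<open>Gauge integrals of nonnegative functions are Lebesgue integrals; this makes the
  explicit integrals of powers and the Beta integral usable for
  \<open>convolution\<close>.\<close>

lemma nonneg_has_integral_lborel:
  fixes h :: "real \<Rightarrow> real"
  assumes I: "(h has_integral I) {a..b}" and [measurable]: "h \<in> borel_measurable borel"
    and nn: "\<And>x. x \<in> {a..b} \<Longrightarrow> 0 \<le> h x"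
  shows "set_integrable lborel {a..b} h" "(LINT x:{a..b}|lborel. h x) = I"
proof -
  have "h absolutely_integrable_on {a..b}"
    using I nn by (intro nonnegative_absolutely_integrable_1) (auto intro: has_integral_integrable)
  then show *: "set_integrable lborel {a..b} h"
    unfolding set_integrable_def by (subst (asm) integrable_completion) auto
  show "(LINT x:{a..b}|lborel. h x) = I"
    using set_borel_integral_eq_integral(2)[OF *] integral_unique[OF I] by simp
qed

text \<open>Cut off at \<open>T\<close> because powers are not integrable on the whole half
  line.\<close>

definition frac_kernel :: "real \<Rightarrow> real \<Rightarrow> real \<Rightarrow> complex" where
  "frac_kernel T \<mu> u = (if u \<in> {0..T} then of_real (u powr (\<mu> - 1) / Gamma \<mu>) else 0)"

lemma frac_int_eq_conv_op: "frac_int T \<mu> f = conv_op T (frac_kernel T \<mu>) f"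
proof
  fix t show "frac_int T \<mu> f t = conv_op T (frac_kernel T \<mu>) f t"
  proof (cases "t \<in> {0..T}")
    case True
    have "integral {0..t} (\<lambda>s. frac_kernel T \<mu> (t - s) * f s)
        = integral {0..t} (\<lambda>s. (1 / Gamma \<mu>) *\<^sub>R ((t - s) powr (\<mu> - 1) *\<^sub>R f s))"
      using True by (intro integral_cong) (auto simp: frac_kernel_def scaleR_conv_of_real)
    also have "\<dots> = (1 / Gamma \<mu>) *\<^sub>R integral {0..t} (\<lambda>s. (t - s) powr (\<mu> - 1) *\<^sub>R f s)"
      by (rule integral_cmul)
    finally show ?thesis using True by (simp add: frac_int_def conv_op_def)
  qed (auto simp: frac_int_def conv_op_def)
qed

lemma frac_kernel_causal:
  assumes "T > 0" "\<mu> > 0"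
  shows "frac_kernel T \<mu> \<in> causal_kernels"
proof -
  have "((\<lambda>x. x powr (\<mu> - 1)) has_integral (T powr (\<mu> - 1 + 1) / (\<mu> - 1 + 1))) {0..T}"
    using assms by (intro has_integral_powr_from_0) auto
  then have "set_integrable lborel {0..T} (\<lambda>x. x powr (\<mu> - 1))"
    by (rule nonneg_has_integral_lborel(1)) auto
  then have "integrable lborel (\<lambda>x. complex_of_real (indicator {0..T} x *\<^sub>R x powr (\<mu> - 1)) / of_real (Gamma \<mu>))"
    unfolding set_integrable_def by (intro integrable_divide_zero integrable_of_real) simp_all
  also have "(\<lambda>x. complex_of_real (indicator {0..T} x *\<^sub>R x powr (\<mu> - 1)) / of_real (Gamma \<mu>)) = frac_kernel T \<mu>"
    by (auto simp: frac_kernel_def indicator_def fun_eq_iff)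
  finally show ?thesis
    by (auto simp: causal_kernels_def) (simp add: frac_kernel_def)
qed

text \<open>Rescaling the Beta integral over \<open>{0..1}\<close> by \<open>s = t
  x\<close>.\<close>

lemma has_integral_beta_convolution:
  fixes \<mu> \<nu> t :: real
  assumes "\<mu> > 0" "\<nu> > 0" "t > 0"
  shows "((\<lambda>s. (t - s) powr (\<mu> - 1) * s powr (\<nu> - 1)) has_integral
           t powr (\<mu> + \<nu> - 1) * Beta \<mu> \<nu>) {0..t}"
proof -
  have img: "(\<lambda>x. x / (1 / t)) ` {0..1} = {0..t}"
    using assms image_mult_atLeastAtMost[of t 0 1] by (simp add: mult.commute)
  have "((\<lambda>s. (1/t * s) powr (\<nu> - 1) * (1 - 1/t * s) powr (\<mu> - 1)) has_integral
          (1 / \<bar>1/t\<bar>) *\<^sub>R Beta \<nu> \<mu>) ((\<lambda>x. x / (1 / t)) ` {0..1})"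
    by (rule has_integral_stretch_real[OF has_integral_Beta_real]) (use assms in auto)
  then have "((\<lambda>s. t powr (\<mu> + \<nu> - 2) * ((1/t * s) powr (\<nu> - 1) * (1 - 1/t * s) powr (\<mu> - 1))) has_integral
          t powr (\<mu> + \<nu> - 2) * ((1 / \<bar>1/t\<bar>) *\<^sub>R Beta \<nu> \<mu>)) {0..t}"
    unfolding img by (rule has_integral_mult_right)
  also have "t powr (\<mu> + \<nu> - 2) * ((1 / \<bar>1/t\<bar>) *\<^sub>R Beta \<nu> \<mu>) = t powr (\<mu> + \<nu> - 1) * Beta \<mu> \<nu>"
  proof -
    have "t powr (\<mu> + \<nu> - 1) = t powr (\<mu> + \<nu> - 2) * t"
      using assms powr_add[of t "\<mu> + \<nu> - 2" 1] by simp
    then show ?thesis using assms by (simp add: Beta_commute)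
  qed
  finally show ?thesis
  proof (rule has_integral_eq[rotated])
    fix s assume s: "s \<in> {0..t}"
    have "1 - 1/t * s = (t - s) / t" using assms by (simp add: field_simps)
    moreover have "t powr (\<mu> + \<nu> - 2) = t powr (\<nu> - 1) * t powr (\<mu> - 1)"
      by (simp add: powr_add[symmetric] algebra_simps)
    ultimately show "t powr (\<mu> + \<nu> - 2) * ((1/t * s) powr (\<nu> - 1) * (1 - 1/t * s) powr (\<mu> - 1))
        = (t - s) powr (\<mu> - 1) * s powr (\<nu> - 1)"
      using assms s by (simp add: powr_divide)
  qed
qed

lemma convolution_frac_kernel:
  assumes "T > 0" "\<mu> > 0" "\<nu> > 0" "t \<in> {0..T}"
  shows "convolution (frac_kernel T \<mu>) (frac_kernel T \<nu>) t = frac_kernel T (\<mu> + \<nu>) t"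
proof (cases "t = 0")
  case True
  \<comment> \<open>Fractional kernels vanish at \<open>0\<close> for every order, since \<open>0 powr x = 0\<close>.\<close>
  have "(\<lambda>s. frac_kernel T \<mu> (0 - s) * frac_kernel T \<nu> s) = (\<lambda>s. 0)"
    by (auto simp: frac_kernel_def fun_eq_iff)
  then show ?thesis by (simp add: True convolution_def frac_kernel_def)
next
  case False
  then have t: "t > 0" using assms by auto
  let ?h = "\<lambda>s. (t - s) powr (\<mu> - 1) * s powr (\<nu> - 1)"
  have eq: "(\<lambda>s. frac_kernel T \<mu> (t - s) * frac_kernel T \<nu> s)
      = (\<lambda>s. complex_of_real (indicator {0..t} s *\<^sub>R ?h s) / of_real (Gamma \<mu> * Gamma \<nu>))"
    using assms by (auto simp: frac_kernel_def indicator_def fun_eq_iff)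
  have "(LINT s:{0..t}|lborel. ?h s) = t powr (\<mu> + \<nu> - 1) * Beta \<mu> \<nu>"
    by (rule nonneg_has_integral_lborel(2)[OF has_integral_beta_convolution]) (use assms t in auto)
  then have "convolution (frac_kernel T \<mu>) (frac_kernel T \<nu>) t
      = of_real (t powr (\<mu> + \<nu> - 1) * Beta \<mu> \<nu>) / of_real (Gamma \<mu> * Gamma \<nu>)"
    unfolding convolution_def eq set_lebesgue_integral_def integral_divide_zero integral_complex_of_real
    by simp
  moreover have "Gamma \<mu> \<noteq> 0" "Gamma \<nu> \<noteq> 0"
    using assms(2,3) Gamma_real_pos by (metis less_irrefl)+
  ultimately show ?thesis
    using assms(4) by (simp add: frac_kernel_def Beta_def)
qed

lemma frac_int_compose:
  assumes "T > 0" "\<mu> > 0" "\<nu> > 0" "f \<in> bounded_causal"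
  shows "frac_int T \<mu> (frac_int T \<nu> f) = frac_int T (\<mu> + \<nu>) f"
  unfolding frac_int_eq_conv_op
  using assms by (intro conv_op_assoc frac_kernel_causal convolution_frac_kernel[symmetric])

lemma frac_int_1:
  assumes "t \<in> {0..T}"
  shows "frac_int T 1 f t = integral {0..t} f"
proof -
  have "integral {0..t} (\<lambda>s. (t - s) powr (1 - 1) *\<^sub>R f s) = integral {0..t} f"
    by (rule integral_spike[of "{t}"]) (use assms in auto)
  then show ?thesis using assms by (simp add: frac_int_def)
qed

lemma frac_int_1_deriv_on:
  assumes "T > 0" "f \<in> flat_space T"
  shows "frac_int T 1 (deriv_on T f) = f"
proof
  fix t show "frac_int T 1 (deriv_on T f) t = f t"
  proof (cases "t \<in> {0..T}")
    case True
    have "(deriv_on T f has_integral f t - f 0) {0..t}"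
    proof (rule fundamental_theorem_of_calculus)
      fix s assume "s \<in> {0..t}"
      then have "(f has_vector_derivative deriv_on T f s) (at s within {0..T})"
        using True assms by (intro flat_space_has_deriv) auto
      then show "(f has_vector_derivative deriv_on T f s) (at s within {0..t})"
        by (rule has_vector_derivative_within_subset) (use True in auto)
    qed (use True in auto)
    then show ?thesis using True flat_space_at_0[OF assms(2)] by (simp add: frac_int_1 integral_unique)
  qed (use assms in \<open>auto simp: frac_int_def flat_space_outside\<close>)
qed

lemma conv_op_commute:
  assumes "k \<in> causal_kernels" "f \<in> bounded_causal" "k \<in> bounded_causal" "f \<in> causal_kernels"
  shows "conv_op T k f = conv_op T f k"
proof
  show "conv_op T k f t = conv_op T f k t" for t
    using assms convolution_commute[of k f t]
    by (cases "t \<in> {0..T}") (auto simp: conv_op_eq_convolution conv_op_outside)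
qed

text \<open>Both sides are the convolution of \<open>f\<close> with \<open>k * l = l *
  k\<close>.\<close>

lemma conv_op_left_commute:
  assumes "k \<in> causal_kernels" "l \<in> causal_kernels" "f \<in> bounded_causal"
  shows "conv_op T k (conv_op T l f) = conv_op T l (conv_op T k f)"
proof -
  have "conv_op T k (conv_op T l f) = conv_op T (convolution k l) f"
    using assms by (intro conv_op_assoc) auto
  also have "\<dots> = conv_op T l (conv_op T k f)"
    using assms by (intro conv_op_assoc[symmetric] convolution_commute)
  finally show ?thesis .
qed

lemma bounded_causal_integrable_on:
  assumes "f \<in> bounded_causal"
  shows "f integrable_on {0..t}"
proof -
  obtain B where "\<And>s. norm (f s) \<le> B" "f \<in> borel_measurable lborel"
    using assms by (auto simp: bounded_causal_def)
  then have "integrable lborel (\<lambda>s. complex_of_real (indicator {0..t} s) * f s)"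
    by (intro integrable_mult_bounded integrable_of_real integrable_real_indicator)
      (auto simp: emeasure_lborel_Icc_eq)
  then have "set_integrable lborel {0..t} f"
    unfolding set_integrable_def by (rule Bochner_Integration.integrable_cong[THEN iffD1, rotated 2])
      (auto simp: indicator_def)
  then show ?thesis by (rule set_borel_integral_eq_integral)
qed

text \<open>The form \<open>k * f = 1 * (k * f')\<close> of a convolution: it follows from
  \<open>f = 1 * f'\<close> because convolutions commute. Applied to \<open>f\<close> it shows
  that \<open>k * f\<close> is continuous, and applied to \<open>f'\<close>, that the integrand
  is continuous, so that \<open>k * f\<close> is differentiable; no limit is taken under the
  integral sign.\<close>

lemma conv_op_eq_integral:
  assumes T: "T > 0" and k: "k \<in> causal_kernels" and f: "f \<in> flat_space T" and t: "t \<in> {0..T}"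
  shows "conv_op T k f t = integral {0..t} (conv_op T k (deriv_on T f))"
proof -
  have f': "deriv_on T f \<in> bounded_causal"
    by (intro flat_space_causal(2)[OF T] flat_space_deriv_on f)
  have "conv_op T k f = conv_op T k (frac_int T 1 (deriv_on T f))"
    by (simp add: frac_int_1_deriv_on[OF T f])
  also have "\<dots> = frac_int T 1 (conv_op T k (deriv_on T f))"
    unfolding frac_int_eq_conv_op
    by (intro conv_op_left_commute k f' frac_kernel_causal T) auto
  finally show ?thesis by (simp add: frac_int_1[OF t])
qed

lemma conv_op_continuous_on:
  assumes T: "T > 0" and k: "k \<in> causal_kernels" and f: "f \<in> flat_space T"
  shows "continuous_on {0..T} (conv_op T k f)"
proof -
  have f': "deriv_on T f \<in> bounded_causal"
    by (intro flat_space_causal(2)[OF T] flat_space_deriv_on f)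
  have "conv_op T k (deriv_on T f) integrable_on {0..T}"
    by (rule integrable_eq[OF bounded_causal_integrable_on[OF convolution_bounded_causal[OF k f']]])
      (simp add: conv_op_eq_convolution[OF k f'])
  from indefinite_integral_continuous_1[OF this] show ?thesis
    by (rule continuous_on_eq) (simp add: conv_op_eq_integral[OF assms])
qed

lemma conv_op_has_deriv:
  assumes T: "T > 0" and k: "k \<in> causal_kernels" and f: "f \<in> flat_space T" and t: "t \<in> {0..T}"
  shows "(conv_op T k f has_vector_derivative conv_op T k (deriv_on T f) t) (at t within {0..T})"
proof (rule has_vector_derivative_transform[OF t _ integral_has_vector_derivative[OF _ t]])
  show "continuous_on {0..T} (conv_op T k (deriv_on T f))"
    by (intro conv_op_continuous_on T k flat_space_deriv_on f)
  show "conv_op T k f s = integral {0..s} (conv_op T k (deriv_on T f))" if "s \<in> {0..T}" for s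
    by (rule conv_op_eq_integral[OF T k f that])
qed

lemma flat_space_conv_op:
  assumes T: "T > 0" and k: "k \<in> causal_kernels" and f: "f \<in> flat_space T"
  shows "conv_op T k f \<in> flat_space T"
proof (rule flat_space_coinduct[where S = "conv_op T k ` flat_space T"])
  fix g assume "g \<in> conv_op T k ` flat_space T"
  then obtain f where "g = conv_op T k f" "f \<in> flat_space T" by auto
  then show "\<exists>g'\<in>conv_op T k ` flat_space T. \<forall>t\<in>{0..T}. (g has_vector_derivative g' t) (at t within {0..T})"
    using conv_op_has_deriv[OF T k] flat_space_deriv_on by blast
next
  fix g :: "real \<Rightarrow> complex" and t assume "g \<in> conv_op T k ` flat_space T" "t \<notin> {0..T}"
  then show "g t = 0" by (auto simp: conv_op_def)
qed (use T f in \<open>auto simp: conv_op_def\<close>)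

lemma deriv_on_conv_op:
  assumes "T > 0" "k \<in> causal_kernels" "f \<in> flat_space T"
  shows "deriv_on T (conv_op T k f) = conv_op T k (deriv_on T f)"
  by (intro deriv_on_eqI conv_op_has_deriv conv_op_outside assms)

lemma nderiv_conv_op:
  assumes "T > 0" "k \<in> causal_kernels" "f \<in> flat_space T"
  shows "nderiv T n (conv_op T k f) = conv_op T k (nderiv T n f)"
  by (induction n) (simp_all add: nderiv_Suc' deriv_on_conv_op flat_space_nderiv assms)

lemma conv_op_add_right:
  assumes "k \<in> causal_kernels" "f \<in> bounded_causal" "g \<in> bounded_causal"
  shows "conv_op T k (\<lambda>s. f s + g s) = (\<lambda>t. conv_op T k f t + conv_op T k g t)"
  using assms by (auto simp: conv_op_def fun_eq_iff distrib_left integral_add conv_op_integrable)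

lemma conv_op_add_left:
  assumes "k \<in> causal_kernels" "l \<in> causal_kernels" "f \<in> bounded_causal"
  shows "conv_op T (\<lambda>s. k s + l s) f = (\<lambda>t. conv_op T k f t + conv_op T l f t)"
  using assms by (auto simp: conv_op_def fun_eq_iff distrib_right integral_add conv_op_integrable)

lemma conv_op_cmult_right: "conv_op T k (\<lambda>s. c * f s) = (\<lambda>t. c * conv_op T k f t)"
  by (auto simp: conv_op_def fun_eq_iff mult.left_commute)

text \<open>Since \<open>s = t - (t - s)\<close>. The kernel \<open>u k(u)\<close> is given as a
  separate function \<open>l\<close> so that the lemma also applies to the fractional kernels,
  where \<open>l\<close> is a multiple of the kernel of the next order.\<close>

lemma conv_op_tmult_right:
  assumes k: "k \<in> causal_kernels" and l: "l \<in> causal_kernels" and f: "f \<in> bounded_causal"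
    and kl: "\<And>u. u \<in> {0..T} \<Longrightarrow> l u = of_real u * k u"
  shows "conv_op T k (\<lambda>s. of_real s * f s) = (\<lambda>t. of_real t * conv_op T k f t - conv_op T l f t)"
proof
  fix t show "conv_op T k (\<lambda>s. of_real s * f s) t = of_real t * conv_op T k f t - conv_op T l f t"
  proof (cases "t \<in> {0..T}")
    case True
    have "integral {0..t} (\<lambda>s. k (t - s) * (of_real s * f s))
        = integral {0..t} (\<lambda>s. of_real t * (k (t - s) * f s) - l (t - s) * f s)"
      using True kl by (intro integral_cong) (auto simp: algebra_simps)
    also have "\<dots> = of_real t * integral {0..t} (\<lambda>s. k (t - s) * f s) - integral {0..t} (\<lambda>s. l (t - s) * f s)"
      using conv_op_integrable[OF k f] conv_op_integrable[OF l f]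
      by (subst integral_diff) (auto intro: integrable_on_mult_right)
    finally show ?thesis using True by (simp add: conv_op_def)
  qed (auto simp: conv_op_def)
qed

section \<open>Calculus of fractional derivatives\<close>

context
  fixes T :: real
  assumes T: "T > 0"
begin

lemma frac_int_flat:
  assumes "\<mu> > 0" "f \<in> flat_space T"
  shows "frac_int T \<mu> f \<in> flat_space T"
  unfolding frac_int_eq_conv_op by (intro flat_space_conv_op frac_kernel_causal T assms)

lemma nderiv_frac_int:
  assumes "\<mu> > 0" "f \<in> flat_space T"
  shows "nderiv T n (frac_int T \<mu> f) = frac_int T \<mu> (nderiv T n f)"
  unfolding frac_int_eq_conv_op by (intro nderiv_conv_op frac_kernel_causal T assms)

lemma frac_int_Suc_deriv_on:
  assumes "\<mu> > 0" "f \<in> flat_space T"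
  shows "frac_int T (\<mu> + 1) (deriv_on T f) = frac_int T \<mu> f"
  using frac_int_compose[OF T assms(1) zero_less_one flat_space_causal(2)[OF T flat_space_deriv_on[OF assms(2)]]]
  by (simp add: frac_int_1_deriv_on[OF T assms(2)])

text \<open>Raising \<open>n\<close> by one does not change the right-hand side, because
  \<open>J\<^bsup>\<mu> + 1\<^esup> f' = J\<^sup>\<mu> f\<close> on the flat space.\<close>

lemma frac_deriv_eq:
  assumes f: "f \<in> flat_space T" and n: "real n > \<alpha>"
  shows "frac_deriv T \<alpha> f = frac_int T (real n - \<alpha>) (nderiv T n f)"
proof -
  have up: "frac_int T (real n - \<alpha>) (nderiv T n f) = frac_int T (real m - \<alpha>) (nderiv T m f)"
    if "m \<le> n" "real m > \<alpha>" for m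
    using that(1)
  proof (induction n rule: dec_induct)
    case (step n)
    then show ?case using \<open>real m > \<alpha>\<close> assms(1) 
      frac_int_Suc_deriv_on[of "real n - \<alpha>" "nderiv T n f"]
      by (simp add: flat_space_nderiv nderiv_Suc' algebra_simps)
  qed simp
  consider "\<alpha> < 0" | "\<alpha> = 0" | "\<alpha> > 0" by linarith
  then show ?thesis
  proof cases
    case 1
    then show ?thesis using up[of 0] by (simp add: frac_deriv_def)
  next
    case 2
    then have "frac_int T (real n - \<alpha>) (nderiv T n f) = frac_int T (real 1 - \<alpha>) (nderiv T 1 f)"
      using n by (intro up) auto
    then show ?thesis using 2 f T by (simp add: frac_deriv_def nderiv_Suc' frac_int_1_deriv_on)
  next
    case 3
    let ?m = "LEAST n::nat. \<alpha> < real n"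
    have "?m \<le> n" "real ?m > \<alpha>"
      using n by (auto intro: Least_le LeastI)
    then show ?thesis using 3 up[of ?m] by (simp add: frac_deriv_def Let_def)
  qed
qed

lemma frac_deriv_flat:
  assumes f: "f \<in> flat_space T"
  shows "frac_deriv T \<alpha> f \<in> flat_space T"
proof -
  obtain n :: nat where n: "real n > \<alpha>" using reals_Archimedean2 by blast
  show ?thesis
    unfolding frac_deriv_eq[OF f n] using n f by (intro frac_int_flat flat_space_nderiv) auto
qed

text \<open>Choose integers above both orders, move all ordinary derivatives past the fractional
  integrals, and combine the integrals.\<close>

lemma frac_deriv_compose:
  assumes f: "f \<in> flat_space T"
  shows "frac_deriv T \<alpha> (frac_deriv T \<beta> f) = frac_deriv T (\<alpha> + \<beta>) f"
proof -
  obtain n m :: nat where n: "real n > \<alpha>" and m: "real m > \<beta>" using reals_Archimedean2 by blast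
  have "frac_deriv T \<alpha> (frac_deriv T \<beta> f) = frac_int T (real n - \<alpha>) (nderiv T n (frac_deriv T \<beta> f))"
    by (rule frac_deriv_eq[OF frac_deriv_flat[OF f] n])
  also have "\<dots> = frac_int T (real n - \<alpha>) (nderiv T n (frac_int T (real m - \<beta>) (nderiv T m f)))"
    by (simp only: frac_deriv_eq[OF f m])
  also have "\<dots> = frac_int T (real n - \<alpha>) (frac_int T (real m - \<beta>) (nderiv T (n + m) f))"
    using m f by (simp add: nderiv_frac_int flat_space_nderiv nderiv_add)
  also have "\<dots> = frac_int T (real n - \<alpha> + (real m - \<beta>)) (nderiv T (n + m) f)"
    using n m f by (intro frac_int_compose T flat_space_causal(2)[OF T] flat_space_nderiv) auto
  also have "\<dots> = frac_deriv T (\<alpha> + \<beta>) f"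
    using frac_deriv_eq[OF f, of "\<alpha> + \<beta>" "n + m"] n m by (simp add: algebra_simps)
  finally show ?thesis .
qed

lemma frac_deriv_0 [simp]: "frac_deriv T 0 f = f"
  by (simp add: frac_deriv_def)

lemma frac_deriv_1:
  assumes f: "f \<in> flat_space T"
  shows "frac_deriv T 1 f = deriv_on T f"
  using frac_deriv_eq[OF f, of 1 2] frac_int_1_deriv_on[OF T flat_space_deriv_on[OF f]]
  by (simp add: nderiv_Suc' numeral_2_eq_2)

lemma nderiv_add_fun:
  assumes "f \<in> flat_space T" "g \<in> flat_space T"
  shows "nderiv T n (\<lambda>t. f t + g t) = (\<lambda>t. nderiv T n f t + nderiv T n g t)"
proof (induction n)
  case (Suc n)
  have "deriv_on T (\<lambda>t. nderiv T n f t + nderiv T n g t) = (\<lambda>t. nderiv T (Suc n) f t + nderiv T (Suc n) g t)"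
    unfolding nderiv_Suc'
    by (intro deriv_on_eqI T has_vector_derivative_add flat_space_has_deriv)
      (use assms flat_space_nderiv in \<open>auto simp: deriv_on_def\<close>)
  then show ?case using Suc by (simp add: nderiv_Suc')
qed simp

lemma nderiv_cmult:
  assumes "f \<in> flat_space T"
  shows "nderiv T n (\<lambda>t. c * f t) = (\<lambda>t. c * nderiv T n f t)"
proof (induction n)
  case (Suc n)
  have "deriv_on T (\<lambda>t. c * nderiv T n f t) = (\<lambda>t. c * nderiv T (Suc n) f t)"
    unfolding nderiv_Suc'
    by (intro deriv_on_eqI T has_vector_derivative_mult_right flat_space_has_deriv)
      (use assms flat_space_nderiv in \<open>auto simp: deriv_on_def\<close>)
  then show ?case using Suc by (simp add: nderiv_Suc')
qed simp

lemma frac_deriv_add: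
  assumes f: "f \<in> flat_space T" and g: "g \<in> flat_space T"
  shows "frac_deriv T \<alpha> (\<lambda>t. f t + g t) = (\<lambda>t. frac_deriv T \<alpha> f t + frac_deriv T \<alpha> g t)"
proof -
  obtain n :: nat where n: "real n > \<alpha>" using reals_Archimedean2 by blast
  then have "frac_kernel T (real n - \<alpha>) \<in> causal_kernels" using T by (intro frac_kernel_causal) auto
  then show ?thesis
    unfolding frac_deriv_eq[OF f n] frac_deriv_eq[OF g n] frac_deriv_eq[OF flat_space_add[OF T f g] n]
      nderiv_add_fun[OF f g] frac_int_eq_conv_op
    by (intro conv_op_add_right flat_space_causal(2)[OF T] flat_space_nderiv f g)
qed

lemma frac_deriv_cmult:
  assumes f: "f \<in> flat_space T"
  shows "frac_deriv T \<alpha> (\<lambda>t. c * f t) = (\<lambda>t. c * frac_deriv T \<alpha> f t)"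
proof -
  obtain n :: nat where n: "real n > \<alpha>" using reals_Archimedean2 by blast
  show ?thesis
    unfolding frac_deriv_eq[OF f n] frac_deriv_eq[OF flat_space_cmult[OF T f] n]
      nderiv_cmult[OF f] frac_int_eq_conv_op conv_op_cmult_right ..
qed

lemma frac_deriv_conv_op_right:
  assumes k: "k \<in> causal_kernels" and f: "f \<in> flat_space T"
  shows "frac_deriv T \<alpha> (conv_op T k f) = conv_op T k (frac_deriv T \<alpha> f)"
proof -
  obtain n :: nat where n: "real n > \<alpha>" using reals_Archimedean2 by blast
  then have "frac_kernel T (real n - \<alpha>) \<in> causal_kernels" using T by (intro frac_kernel_causal) auto
  then show ?thesis
    unfolding frac_deriv_eq[OF f n] frac_deriv_eq[OF flat_space_conv_op[OF T k f] n]
      nderiv_conv_op[OF T k f] frac_int_eq_conv_op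
    by (intro conv_op_left_commute k flat_space_causal(2)[OF T] flat_space_nderiv f)
qed

lemma flat_conv_op_commute:
  "k \<in> flat_space T \<Longrightarrow> f \<in> flat_space T \<Longrightarrow> conv_op T k f = conv_op T f k"
  by (intro conv_op_commute flat_space_causal[OF T])

text \<open>Both factors are flat, so by commutativity either of them can absorb the
  derivative.\<close>

lemma frac_deriv_conv_op_left:
  assumes k: "k \<in> flat_space T" and f: "f \<in> flat_space T"
  shows "frac_deriv T \<alpha> (conv_op T k f) = conv_op T (frac_deriv T \<alpha> k) f"
  using frac_deriv_conv_op_right[OF flat_space_causal(1)[OF T f] k]
  by (simp add: flat_conv_op_commute[OF k f] flat_conv_op_commute[OF frac_deriv_flat[OF k] f])

lemma conv_op_frac_deriv:
  assumes k: "k \<in> flat_space T" and f: "f \<in> flat_space T"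
  shows "conv_op T k (frac_deriv T \<alpha> f) = conv_op T (frac_deriv T \<alpha> k) f"
  using frac_deriv_conv_op_right[OF flat_space_causal(1)[OF T k] f] frac_deriv_conv_op_left[OF k f]
  by simp

lemma flat_conv_op_assoc:
  assumes "k \<in> flat_space T" "l \<in> flat_space T" "f \<in> flat_space T"
  shows "conv_op T k (conv_op T l f) = conv_op T (conv_op T k l) f"
  using assms by (intro conv_op_assoc conv_op_eq_convolution flat_space_causal[OF T])

lemma flat_conv_op_tmult:
  assumes "k \<in> flat_space T" "f \<in> flat_space T"
  shows "conv_op T k (\<lambda>s. of_real s * f s)
    = (\<lambda>t. of_real t * conv_op T k f t - conv_op T (\<lambda>u. of_real u * k u) f t)"
  using assms by (intro conv_op_tmult_right flat_space_causal[OF T] flat_space_tmult T refl)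

text \<open>The commutation rule \<open>D\<^sup>\<alpha> t = t D\<^sup>\<alpha> + \<alpha>
  D\<^bsup>\<alpha> - 1\<^esup>\<close>. It is additive in \<open>\<alpha>\<close>: if it holds
  for \<open>\<alpha>\<close> and \<open>\<beta>\<close>, it holds for \<open>\<alpha> +
  \<beta>\<close>. For negative orders it is \<open>conv_op_tmult_right\<close> together with
  \<open>\<Gamma>(\<mu> + 1) = \<mu> \<Gamma>(\<mu>)\<close>, for \<open>\<alpha> = 1\<close> it
  is the product rule, and every real number is a natural number plus a negative one.\<close>

lemma frac_deriv_tmult:
  assumes f: "f \<in> flat_space T"
  shows "frac_deriv T \<alpha> (\<lambda>t. of_real t * f t)
    = (\<lambda>t. of_real t * frac_deriv T \<alpha> f t + of_real \<alpha> * frac_deriv T (\<alpha> - 1) f t)"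
proof -
  define P where "P \<alpha> \<longleftrightarrow> (\<forall>f\<in>flat_space T. frac_deriv T \<alpha> (\<lambda>t. of_real t * f t)
    = (\<lambda>t. of_real t * frac_deriv T \<alpha> f t + of_real \<alpha> * frac_deriv T (\<alpha> - 1) f t))" for \<alpha>
  have neg: "P (- \<mu>)" if "\<mu> > 0" for \<mu>
    unfolding P_def
  proof
    fix f assume f: "f \<in> flat_space T"
    have "\<mu> + 1 > 0" using that by simp
    have "Gamma \<mu> \<noteq> 0" using that Gamma_real_pos by (metis less_irrefl)
    moreover have "Gamma (\<mu> + 1) = \<mu> * Gamma \<mu>"
      using that by (intro Gamma_plus1) (auto elim!: nonpos_Ints_cases)
    ultimately have G: "Gamma (\<mu> + 1) = \<mu> * Gamma \<mu>" "Gamma \<mu> \<noteq> 0" by auto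
    have "conv_op T (frac_kernel T \<mu>) (\<lambda>t. of_real t * f t)
      = (\<lambda>t. of_real t * conv_op T (frac_kernel T \<mu>) f t
           - conv_op T (\<lambda>u. of_real \<mu> * frac_kernel T (\<mu> + 1) u) f t)"
    proof (rule conv_op_tmult_right)
      show "frac_kernel T \<mu> \<in> causal_kernels" by (intro frac_kernel_causal T that)
      have "frac_kernel T (\<mu> + 1) \<in> causal_kernels" using that by (intro frac_kernel_causal T) auto
      then show "(\<lambda>u. of_real \<mu> * frac_kernel T (\<mu> + 1) u) \<in> causal_kernels"
        by (auto simp: causal_kernels_def)
      fix u assume u: "u \<in> {0..T}"
      have "u powr \<mu> = u * u powr (\<mu> - 1)"
        using u powr_mult_base[of u "\<mu> - 1"] by simp
      then show "of_real \<mu> * frac_kernel T (\<mu> + 1) u = of_real u * frac_kernel T \<mu> u"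
        using u G that by (simp add: frac_kernel_def)
    qed (rule flat_space_causal(2)[OF T f])
    moreover have "conv_op T (\<lambda>u. of_real \<mu> * frac_kernel T (\<mu> + 1) u) f
        = (\<lambda>t. of_real \<mu> * conv_op T (frac_kernel T (\<mu> + 1)) f t)"
      by (auto simp: conv_op_def fun_eq_iff mult.assoc)
    moreover have "frac_deriv T (- \<mu> - 1) f = frac_int T (\<mu> + 1) f"
      using that by (simp add: frac_deriv_def add.commute)
    ultimately show "frac_deriv T (-\<mu>) (\<lambda>t. of_real t * f t)
      = (\<lambda>t. of_real t * frac_deriv T (-\<mu>) f t + of_real (-\<mu>) * frac_deriv T (-\<mu> - 1) f t)"
      using that by (simp add: frac_deriv_def frac_int_eq_conv_op)
  qed
  have add: "P (\<alpha> + \<beta>)" if "P \<alpha>" "P \<beta>" for \<alpha> \<beta>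
    unfolding P_def
  proof
    fix f assume f: "f \<in> flat_space T"
    have "frac_deriv T (\<alpha> + \<beta>) (\<lambda>t. of_real t * f t) = frac_deriv T \<alpha> (frac_deriv T \<beta> (\<lambda>t. of_real t * f t))"
      by (simp add: frac_deriv_compose flat_space_tmult T f)
    also have "\<dots> = frac_deriv T \<alpha> (\<lambda>t. of_real t * frac_deriv T \<beta> f t + of_real \<beta> * frac_deriv T (\<beta> - 1) f t)"
      using \<open>P \<beta>\<close> f by (simp add: P_def)
    also have "\<dots> = (\<lambda>t. frac_deriv T \<alpha> (\<lambda>t. of_real t * frac_deriv T \<beta> f t) t
        + of_real \<beta> * frac_deriv T \<alpha> (frac_deriv T (\<beta> - 1) f) t)"
      by (simp add: frac_deriv_add frac_deriv_cmult flat_space_tmult flat_space_cmult frac_deriv_flat T f)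
    also have "\<dots> = (\<lambda>t. of_real t * frac_deriv T (\<alpha> + \<beta>) f t + of_real (\<alpha> + \<beta>) * frac_deriv T (\<alpha> + \<beta> - 1) f t)"
    proof -
      have "frac_deriv T \<alpha> (\<lambda>t. of_real t * frac_deriv T \<beta> f t)
          = (\<lambda>t. of_real t * frac_deriv T (\<alpha> + \<beta>) f t + of_real \<alpha> * frac_deriv T (\<alpha> + \<beta> - 1) f t)"
        using \<open>P \<alpha>\<close> frac_deriv_flat[OF f]
        by (simp add: P_def frac_deriv_compose f diff_add_eq)
      then show ?thesis by (simp add: frac_deriv_compose f algebra_simps)
    qed
    finally show "frac_deriv T (\<alpha> + \<beta>) (\<lambda>t. of_real t * f t)
      = (\<lambda>t. of_real t * frac_deriv T (\<alpha> + \<beta>) f t + of_real (\<alpha> + \<beta>) * frac_deriv T (\<alpha> + \<beta> - 1) f t)" .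
  qed
  have one: "P 1"
    unfolding P_def
  proof
    fix f assume f: "f \<in> flat_space T"
    have "deriv_on T (\<lambda>t. of_real t * f t) = (\<lambda>t. of_real t * deriv_on T f t + f t)"
      using f by (intro deriv_on_eqI T deriv_on_tmult) (auto simp: deriv_on_def flat_space_outside)
    then show "frac_deriv T 1 (\<lambda>t. of_real t * f t)
        = (\<lambda>t. of_real t * frac_deriv T 1 f t + of_real 1 * frac_deriv T (1 - 1) f t)"
      by (simp add: frac_deriv_1 flat_space_tmult T f)
  qed
  have nat: "P (real n)" for n
  proof (induction n)
    case (Suc n)
    from add[OF one this] show ?case by simp
  qed (simp add: P_def)
  obtain n :: nat where n: "real n > \<alpha>" using reals_Archimedean2 by blast
  have "P (real n + - (real n - \<alpha>))"
    using n by (intro add nat neg) auto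
  then show ?thesis using f by (simp add: P_def)
qed

end

section \<open>Closure of the normal forms under composition\<close>

text \<open>The linear span of the operators \<open>M\<^sub>p D\<^sup>\<gamma>\<close> and
  \<open>M\<^sub>p V\<^sub>k\<close>, up to equality on the flat space. The inductive form
  allows closure properties to be proved on these operators alone; finite sums with explicit
  coefficients appear only in \<open>representable_normal_form\<close>.\<close>

inductive representable :: "real \<Rightarrow> real set \<Rightarrow> ((real \<Rightarrow> complex) \<Rightarrow> real \<Rightarrow> complex) \<Rightarrow> bool"
  for T \<Gamma> where
  representable_deriv: "\<gamma> \<in> \<Gamma> \<Longrightarrow> representable T \<Gamma> (\<lambda>f. mult_op p (frac_deriv T \<gamma> f))"
| representable_conv: "k \<in> flat_space T \<Longrightarrow> representable T \<Gamma> (\<lambda>f. mult_op p (conv_op T k f))"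
| representable_add: "representable T \<Gamma> A \<Longrightarrow> representable T \<Gamma> B \<Longrightarrow> representable T \<Gamma> (\<lambda>f t. A f t + B f t)"
| representable_cong: "representable T \<Gamma> A \<Longrightarrow> (\<And>f. f \<in> flat_space T \<Longrightarrow> A f = B f) \<Longrightarrow> representable T \<Gamma> B"

lemma mult_op_linear:
  "mult_op p (\<lambda>t. f t + g t) = (\<lambda>t. mult_op p f t + mult_op p g t)"
  "mult_op p (\<lambda>t. c * f t) = (\<lambda>t. c * mult_op p f t)"
  by (auto simp: mult_op_def fun_eq_iff algebra_simps)

lemma mult_op_mult: "mult_op p (mult_op q f) = mult_op (p * q) f"
  by (auto simp: mult_op_def fun_eq_iff)

lemma representable_mult_op:
  "representable T \<Gamma> A \<Longrightarrow> representable T \<Gamma> (\<lambda>f. mult_op p (A f))"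
proof (induction rule: representable.induct)
  case (representable_cong A B)
  then show ?case by (auto intro: representable.representable_cong)
qed (auto simp: mult_op_mult mult_op_linear intro: representable.intros)

lemma representable_cmult:
  "representable T \<Gamma> A \<Longrightarrow> representable T \<Gamma> (\<lambda>f t. c * A f t)"
  using representable_mult_op[of T \<Gamma> A "[:c:]"] by (simp add: mult_op_def[abs_def])

lemma representable_tmult:
  "representable T \<Gamma> A \<Longrightarrow> representable T \<Gamma> (\<lambda>f t. of_real t * A f t)"
  using representable_mult_op[of T \<Gamma> A "[:0, 1:]"] by (simp add: mult_op_def[abs_def])

lemma conv_op_0_right: "conv_op T k (\<lambda>u. 0) = (\<lambda>t. 0)"
  by (auto simp: conv_op_def fun_eq_iff)

lemma mult_op_1: "mult_op 1 f = f"
  by (auto simp: mult_op_def fun_eq_iff)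

context
  fixes T :: real and \<Gamma> :: "real set"
  assumes T: "T > 0" and Z: "\<int> \<subseteq> \<Gamma>"
    and plus: "\<And>x y. x \<in> \<Gamma> \<Longrightarrow> y \<in> \<Gamma> \<Longrightarrow> x + y \<in> \<Gamma>"
begin

lemma representable_zero: "representable T \<Gamma> (\<lambda>f t. 0)"
  using representable_conv[OF flat_space_zero[OF T], of \<Gamma> 0] by (simp add: mult_op_def[abs_def])

lemma representable_linear:
  assumes "representable T \<Gamma> A"
  shows "(\<forall>f\<in>flat_space T. A f \<in> flat_space T)
    \<and> (\<forall>f\<in>flat_space T. \<forall>g\<in>flat_space T. A (\<lambda>t. f t + g t) = (\<lambda>t. A f t + A g t))
    \<and> (\<forall>f\<in>flat_space T. \<forall>c. A (\<lambda>t. c * f t) = (\<lambda>t. c * A f t))"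
  using assms
proof induction
  case (representable_deriv \<gamma> p)
  show ?case
    by (auto simp: T flat_space_mult_op frac_deriv_flat frac_deriv_add frac_deriv_cmult mult_op_linear)
next
  case (representable_conv k p)
  then show ?case
    by (auto simp: T flat_space_mult_op flat_space_conv_op flat_space_causal[OF T] conv_op_add_right
        conv_op_cmult_right mult_op_linear)
next
  case (representable_add A B)
  then show ?case
    by (auto simp: T flat_space_add algebra_simps)
next
  case (representable_cong A B)
  then show ?case
    using flat_space_add[OF T] flat_space_cmult[OF T] by simp
qed

lemmas representable_flat = representable_linear[THEN conjunct1, rule_format]
lemmas representable_fun_add = representable_linear[THEN conjunct2, THEN conjunct1, rule_format]
lemmas representable_fun_cmult = representable_linear[THEN conjunct2, THEN conjunct2, rule_format]

lemma minus_one_closed: "\<gamma> \<in> \<Gamma> \<Longrightarrow> \<gamma> - 1 \<in> \<Gamma>"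
  using plus[of \<gamma> "-1"] Z by (auto simp: subset_iff)

text \<open>Moves \<open>p\<close> to the left of \<open>D\<^sup>\<gamma>\<close>, one factor
  \<open>t\<close> at a time. Each step also produces the order \<open>\<gamma> - 1\<close>, so
  the induction runs over all \<open>\<gamma> \<in> \<Gamma>\<close> simultaneously and needs
  \<open>\<Gamma>\<close> to be closed under subtracting \<open>1\<close>.\<close>

lemma representable_frac_deriv_mult:
  assumes X: "\<And>\<gamma>. \<gamma> \<in> \<Gamma> \<Longrightarrow> representable T \<Gamma> (\<lambda>f. frac_deriv T \<gamma> (X f))"
    and flat: "\<And>f. f \<in> flat_space T \<Longrightarrow> X f \<in> flat_space T"
  shows "\<gamma> \<in> \<Gamma> \<Longrightarrow> representable T \<Gamma> (\<lambda>f. frac_deriv T \<gamma> (mult_op p (X f)))"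
proof (induction p arbitrary: \<gamma>)
  case 0
  have "frac_deriv T \<gamma> (\<lambda>t. 0) = (\<lambda>t. 0)"
    using frac_deriv_cmult[OF T flat_space_zero[OF T], of \<gamma> 0] by simp
  then show ?case using representable_zero by (simp add: mult_op_def[abs_def])
next
  case (pCons a q)
  have "representable T \<Gamma> (\<lambda>f t. a * frac_deriv T \<gamma> (X f) t +
      (of_real t * frac_deriv T \<gamma> (mult_op q (X f)) t + of_real \<gamma> * frac_deriv T (\<gamma> - 1) (mult_op q (X f)) t))"
    using pCons X minus_one_closed by (intro representable_add representable_cmult representable_tmult) auto
  then show ?case
  proof (rule representable_cong)
    fix f assume f: "f \<in> flat_space T"
    show "(\<lambda>t. a * frac_deriv T \<gamma> (X f) t +
      (of_real t * frac_deriv T \<gamma> (mult_op q (X f)) t + of_real \<gamma> * frac_deriv T (\<gamma> - 1) (mult_op q (X f)) t))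
      = frac_deriv T \<gamma> (mult_op (pCons a q) (X f))"
      using flat[OF f]
      by (simp add: mult_op_pCons T flat_space_cmult flat_space_tmult flat_space_mult_op
          frac_deriv_add frac_deriv_cmult frac_deriv_tmult)
  qed
qed

text \<open>As before, with \<open>V\<^sub>k t = t V\<^sub>k - V\<^sub>l\<close> for \<open>l(u)
  = u k(u)\<close>, which is again a flat kernel.\<close>

lemma representable_conv_op_mult:
  assumes X: "\<And>k. k \<in> flat_space T \<Longrightarrow> representable T \<Gamma> (\<lambda>f. conv_op T k (X f))"
    and flat: "\<And>f. f \<in> flat_space T \<Longrightarrow> X f \<in> flat_space T"
  shows "k \<in> flat_space T \<Longrightarrow> representable T \<Gamma> (\<lambda>f. conv_op T k (mult_op p (X f)))"
proof (induction p arbitrary: k)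
  case 0
  then show ?case using representable_zero by (simp add: mult_op_def[abs_def] conv_op_0_right)
next
  case (pCons a q)
  let ?l = "\<lambda>u. of_real u * k u"
  have "representable T \<Gamma> (\<lambda>f t. a * conv_op T k (X f) t +
      (of_real t * conv_op T k (mult_op q (X f)) t + (-1) * conv_op T ?l (mult_op q (X f)) t))"
    using pCons X flat_space_tmult[OF T]
    by (intro representable_add representable_cmult[of T \<Gamma> _ a] representable_cmult[of T \<Gamma> _ "-1"] representable_tmult) auto
  then show ?case
  proof (rule representable_cong)
    fix f assume f: "f \<in> flat_space T"
    show "(\<lambda>t. a * conv_op T k (X f) t +
      (of_real t * conv_op T k (mult_op q (X f)) t + (-1) * conv_op T ?l (mult_op q (X f)) t))
      = conv_op T k (mult_op (pCons a q) (X f))"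
      using flat[OF f] pCons.prems
      by (simp add: mult_op_pCons T flat_space_cmult flat_space_tmult flat_space_mult_op
          flat_space_causal[OF T] conv_op_add_right conv_op_cmult_right flat_conv_op_tmult)
  qed
qed

lemma representable_frac_deriv:
  assumes B: "representable T \<Gamma> B" and g: "\<gamma> \<in> \<Gamma>"
  shows "representable T \<Gamma> (\<lambda>f. frac_deriv T \<gamma> (B f))"
  using B
proof induction
  case (representable_deriv \<delta> p)
  have "representable T \<Gamma> (\<lambda>f. frac_deriv T \<gamma>' (frac_deriv T \<delta> f))" if "\<gamma>' \<in> \<Gamma>" for \<gamma>'
    by (rule representable_cong[OF representable.representable_deriv[OF plus[OF that representable_deriv], of T 1]])
      (simp add: mult_op_1 frac_deriv_compose T)
  from representable_frac_deriv_mult[OF this _ g] show ?case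
    by (simp add: frac_deriv_flat T)
next
  case (representable_conv k p)
  have "representable T \<Gamma> (\<lambda>f. frac_deriv T \<gamma>' (conv_op T k f))" for \<gamma>'
    by (rule representable_cong[OF representable.representable_conv[OF frac_deriv_flat[OF T representable_conv, of \<gamma>'], of \<Gamma> 1]])
      (simp add: mult_op_1 frac_deriv_conv_op_left T representable_conv)
  from representable_frac_deriv_mult[OF this _ g] show ?case
    by (simp add: flat_space_conv_op T flat_space_causal[OF T] representable_conv)
next
  case (representable_add A B)
  then show ?case
    by (intro representable_cong[OF representable.representable_add[OF representable_add.IH]])
      (simp add: frac_deriv_add T representable_flat)
next
  case (representable_cong A B)
  then show ?case by (auto intro: representable.representable_cong)
qed

lemma representable_conv_op:
  assumes B: "representable T \<Gamma> B" and k: "k \<in> flat_space T"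
  shows "representable T \<Gamma> (\<lambda>f. conv_op T k (B f))"
  using B
proof induction
  case (representable_deriv \<delta> p)
  have "representable T \<Gamma> (\<lambda>f. conv_op T k (frac_deriv T \<delta> f))" if "k \<in> flat_space T" for k
    by (rule representable_cong[OF representable.representable_conv[OF frac_deriv_flat[OF T that], of \<Gamma> 1]])
      (simp add: mult_op_1 conv_op_frac_deriv T that)
  from representable_conv_op_mult[OF this _ k] show ?case
    by (simp add: frac_deriv_flat T)
next
  case (representable_conv l p)
  have "representable T \<Gamma> (\<lambda>f. conv_op T k (conv_op T l f))" if k: "k \<in> flat_space T" for k
    by (rule representable_cong[OF representable.representable_conv[of "conv_op T k l" T \<Gamma> 1]])
      (simp_all add: mult_op_1 flat_conv_op_assoc T k representable_conv flat_space_conv_op flat_space_causal[OF T])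
  from representable_conv_op_mult[OF this _ k] show ?case
    by (simp add: flat_space_conv_op T flat_space_causal[OF T] representable_conv)
next
  case (representable_add A B)
  then show ?case
    by (intro representable_cong[OF representable.representable_add[OF representable_add.IH]])
      (simp add: conv_op_add_right representable_flat flat_space_causal[OF T] k)
next
  case (representable_cong A B)
  then show ?case by (auto intro: representable.representable_cong)
qed

lemma representable_compose:
  assumes A: "representable T \<Gamma> A" and B: "representable T \<Gamma> B"
  shows "representable T \<Gamma> (\<lambda>f. A (B f))"
  using A
proof induction
  case (representable_cong A B')
  then show ?case using representable_flat[OF B] by (auto intro: representable.representable_cong)
qed (intro representable_mult_op[OF representable_frac_deriv[OF B]]
      representable_mult_op[OF representable_conv_op[OF B]] representable.representable_add; assumption)+

text \<open>The hull is an intersection of subalgebras, so it suffices that the representable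
  operators form a subalgebra containing the generators; in particular the generators are
  endomorphisms, without which the intersection would be over the empty family.\<close>

lemma frac_algebra_representable:
  assumes "A \<in> frac_algebra T \<Gamma>"
  shows "\<exists>A'. representable T \<Gamma> A' \<and> A = restrict A' (flat_space T)"
proof -
  let ?M = "flat_space T"
  let ?B = "(\<lambda>A. restrict A ?M) ` {A. representable T \<Gamma> A}"
  let ?G = "(\<lambda>p. restrict (mult_op p) ?M) ` UNIV
      \<union> (\<lambda>\<gamma>. restrict (frac_deriv T \<gamma>) ?M) ` \<Gamma>
      \<union> (\<lambda>k. restrict (conv_op T k) ?M) ` ?M"
  have D: "representable T \<Gamma> (frac_deriv T \<gamma>)" if "\<gamma> \<in> \<Gamma>" for \<gamma>
    by (rule representable_cong[OF representable_deriv[OF that, of T 1]]) (simp add: mult_op_1)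
  have V: "representable T \<Gamma> (conv_op T k)" if "k \<in> ?M" for k
    by (rule representable_cong[OF representable_conv[OF that, of \<Gamma> 1]]) (simp add: mult_op_1)
  have "0 \<in> \<Gamma>" using Z by auto
  then have M: "representable T \<Gamma> (mult_op p)" for p
    by (rule representable_cong[OF representable_deriv[of 0 \<Gamma> T p]]) (simp add: T)
  have G: "?G \<subseteq> ?B" using D V M by auto
  have restr_mem: "restrict C ?M \<in> ?B" if "representable T \<Gamma> C'" "\<And>f. f \<in> ?M \<Longrightarrow> C f = C' f" for C C'
    using that by (auto intro!: image_eqI[of _ _ C'] restrict_ext)
  have "flat_subalgebra T ?B"
    unfolding flat_subalgebra_def
  proof (intro conjI ballI allI)
    show "?B \<subseteq> flat_End T"
      by (auto simp: flat_End_def representable_flat representable_fun_add representable_fun_cmult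
          flat_space_add flat_space_cmult T)
    show "(\<lambda>f\<in>?M. f) \<in> ?B"
      by (rule restr_mem[OF M[of 1]]) (simp add: mult_op_1)
    fix X Y c assume "X \<in> ?B" "Y \<in> ?B"
    then obtain A B where A: "representable T \<Gamma> A" "X = restrict A ?M"
      and B: "representable T \<Gamma> B" "Y = restrict B ?M" by blast
    show "(\<lambda>f\<in>?M. \<lambda>t. X f t + Y f t) \<in> ?B"
      by (rule restr_mem[OF representable_add[OF A(1) B(1)]]) (simp add: A B)
    show "(\<lambda>f\<in>?M. X (Y f)) \<in> ?B"
      by (rule restr_mem[OF representable_compose[OF A(1) B(1)]]) (simp add: A B representable_flat)
  next
    fix X c assume "X \<in> ?B"
    then obtain A where A: "representable T \<Gamma> A" "X = restrict A ?M" by blast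
    show "(\<lambda>f\<in>?M. \<lambda>t. c * X f t) \<in> ?B"
      by (rule restr_mem[OF representable_cmult[OF A(1), of c]]) (simp add: A)
  qed
  then have "frac_algebra T \<Gamma> \<subseteq> ?B"
    unfolding frac_algebra_def using G by (intro hull_minimal)
  then show ?thesis using assms by blast
qed

end

section \<open>Separating kernels and powers\<close>

lemma tendsto_poly_times_exp_neg: "((\<lambda>x::real. poly P x * exp (- x)) \<longlongrightarrow> 0) at_top"
proof -
  have "((\<lambda>x. \<Sum>i\<le>degree P. coeff P i * (x ^ i / exp x)) \<longlongrightarrow> (\<Sum>i\<le>degree P. coeff P i * 0)) at_top"
    by (intro tendsto_intros tendsto_power_div_exp_0)
  then show ?thesis
    by (simp add: poly_altdef sum_distrib_right exp_minus divide_inverse mult.assoc)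
qed

text \<open>The classical flat functions \<open>P(1/s) exp (-1/s)\<close>. A whole family is
  needed, as differentiation changes \<open>P\<close> into \<open>X^2 (P - P')\<close>.\<close>

definition flat_exp :: "real \<Rightarrow> real poly \<Rightarrow> real \<Rightarrow> real" where
  "flat_exp T P s = (if s \<in> {0<..T} then poly P (inverse s) * exp (- (inverse s)) else 0)"

lemma flat_exp_has_deriv:
  assumes "T > 0" "s \<in> {0..T}"
  shows "(flat_exp T P has_real_derivative flat_exp T ([:0, 0, 1:] * (P - pderiv P)) s) (at s within {0..T})"
proof (cases "s = 0")
  case True
  \<comment> \<open>The difference quotient at \<open>0\<close> is \<open>P(x) x exp (-x)\<close> with \<open>x = 1/y\<close>.\<close>
  have "((\<lambda>y. poly ([:0, 1:] * P) (inverse y) * exp (- inverse y)) \<longlongrightarrow> 0) (at_right (0::real))"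
    by (rule filterlim_compose[OF tendsto_poly_times_exp_neg filterlim_inverse_at_top_right])
  moreover have "eventually (\<lambda>y. y \<in> {0<..<T}) (at_right 0)"
    using assms(1) by (rule eventually_at_right_real)
  then have "eventually (\<lambda>y. poly ([:0, 1:] * P) (inverse y) * exp (- inverse y)
      = (flat_exp T P y - flat_exp T P 0) / (y - 0)) (at_right 0)"
    by eventually_elim (auto simp: flat_exp_def field_simps)
  ultimately have "((\<lambda>y. (flat_exp T P y - flat_exp T P 0) / (y - 0)) \<longlongrightarrow> 0) (at_right 0)"
    by (rule Lim_transform_eventually)
  then show ?thesis
    using True assms(1) by (simp add: has_field_derivative_iff at_within_Icc_at_right flat_exp_def)
next
  case False
  then have s: "s > 0" "s \<le> T" using assms by auto
  have "(inverse has_real_derivative - (inverse s * inverse s)) (at s within {0..T})"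
    using DERIV_inverse'[OF DERIV_ident, of s "{0..T}"] s by simp
  then have "((\<lambda>s. poly P (inverse s) * exp (- inverse s)) has_real_derivative
      poly (pderiv P) (inverse s) * - (inverse s * inverse s) * exp (- inverse s)
      + exp (- inverse s) * - (- (inverse s * inverse s)) * poly P (inverse s)) (at s within {0..T})"
    by (intro DERIV_mult DERIV_chain2[OF poly_DERIV] DERIV_chain2[OF DERIV_exp] DERIV_minus)
  moreover have "poly (pderiv P) (inverse s) * - (inverse s * inverse s) * exp (- inverse s)
      + exp (- inverse s) * - (- (inverse s * inverse s)) * poly P (inverse s)
      = flat_exp T ([:0, 0, 1:] * (P - pderiv P)) s"
    using s by (simp add: flat_exp_def algebra_simps)
  ultimately have "((\<lambda>s. poly P (inverse s) * exp (- inverse s)) has_real_derivative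
      flat_exp T ([:0, 0, 1:] * (P - pderiv P)) s) (at s within {0..T})"
    by simp
  then show ?thesis
  proof (rule has_field_derivative_transform_within[where d = s])
    fix x assume "x \<in> {0..T}" "dist x s < s"
    then show "poly P (inverse x) * exp (- (inverse x)) = flat_exp T P x"
      by (auto simp: flat_exp_def dist_real_def)
  qed (use s in auto)
qed

lemma flat_exp_flat:
  assumes "T > 0"
  shows "(\<lambda>s. of_real (flat_exp T P s)) \<in> flat_space T"
proof (rule flat_space_coinduct[where S = "range (\<lambda>P s. complex_of_real (flat_exp T P s))"])
  fix g assume "g \<in> range (\<lambda>P s. complex_of_real (flat_exp T P s))"
  then obtain P where g: "g = (\<lambda>s. complex_of_real (flat_exp T P s))" by auto
  show "\<exists>g'\<in>range (\<lambda>P s. complex_of_real (flat_exp T P s)).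
      \<forall>t\<in>{0..T}. (g has_vector_derivative g' t) (at t within {0..T})"
    unfolding g
    by (intro bexI[of _ "\<lambda>s. complex_of_real (flat_exp T ([:0, 0, 1:] * (P - pderiv P)) s)"]
        ballI has_vector_derivative_of_real flat_exp_has_deriv assms rangeI)
qed (use assms in \<open>auto simp: flat_exp_def\<close>)

text \<open>Approximating \<open>u\<close> uniformly by polynomials \<open>q\<close> bounds
  \<open>\<integral> u\<^sup>2 = \<integral> u (u - q)\<close> by arbitrarily small
  numbers.\<close>

lemma orthogonal_to_polynomials_eq_0:
  fixes u :: "real \<Rightarrow> real"
  assumes ab: "a < b" and u: "continuous_on {a..b} u"
    and orth: "\<And>q. real_polynomial_function q \<Longrightarrow> integral {a..b} (\<lambda>s. u s * q s) = 0"
    and s: "s \<in> {a..b}"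
  shows "u s = 0"
proof -
  have uu: "continuous_on {a..b} (\<lambda>s. u s * u s)" by (intro continuous_intros u)
  define I where "I = integral {a..b} (\<lambda>s. \<bar>u s\<bar>)"
  have "integral {a..b} (\<lambda>s. u s * u s) \<le> \<epsilon> * I" if "\<epsilon> > 0" for \<epsilon>
  proof -
    obtain q where q: "real_polynomial_function q" "\<And>x. x \<in> {a..b} \<Longrightarrow> \<bar>u x - q x\<bar> < \<epsilon>"
      using Stone_Weierstrass_real_polynomial_function[OF compact_Icc u \<open>\<epsilon> > 0\<close>] by metis
    have cq: "continuous_on {a..b} q"
      using q(1) by (intro continuous_on_polymonial_function) (simp add: real_polynomial_function_eq)
    have "integral {a..b} (\<lambda>s. u s * u s) = integral {a..b} (\<lambda>s. u s * (u s - q s) + u s * q s)"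
      by (simp add: algebra_simps)
    also have "\<dots> = integral {a..b} (\<lambda>s. u s * (u s - q s))"
      using orth[OF q(1)] by (subst integral_add) (auto intro!: integrable_continuous_real continuous_intros u cq)
    also have "\<dots> \<le> integral {a..b} (\<lambda>s. \<epsilon> * \<bar>u s\<bar>)"
    proof (rule integral_le)
      fix x assume "x \<in> {a..b}"
      then have "\<bar>u x\<bar> * \<bar>u x - q x\<bar> \<le> \<bar>u x\<bar> * \<epsilon>" using q(2) by (intro mult_left_mono) (auto intro: less_imp_le)
      then show "u x * (u x - q x) \<le> \<epsilon> * \<bar>u x\<bar>"
        by (metis abs_ge_self abs_mult mult.commute order_trans)
    qed (auto intro!: integrable_continuous_real continuous_intros u cq)
    finally show ?thesis by (simp add: I_def)
  qed
  note le = this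
  have "I \<ge> 0" unfolding I_def by (intro integral_nonneg integrable_continuous_real continuous_intros u) auto
  have "integral {a..b} (\<lambda>s. u s * u s) \<le> 0"
  proof (rule field_le_epsilon)
    fix e :: real assume "e > 0"
    \<comment> \<open>Dividing by \<open>I + 1\<close> avoids the case \<open>I = 0\<close>.\<close>
    have "e / (I + 1) * I \<le> e" using \<open>e > 0\<close> \<open>I \<ge> 0\<close> by (simp add: field_simps)
    then show "integral {a..b} (\<lambda>s. u s * u s) \<le> 0 + e"
      using le[of "e / (I + 1)"] \<open>e > 0\<close> \<open>I \<ge> 0\<close> by simp
  qed
  moreover have "integral {a..b} (\<lambda>s. u s * u s) \<ge> 0"
    by (intro integral_nonneg integrable_continuous_real uu) auto
  ultimately have "integral {a..b} (\<lambda>s. u s * u s) = 0" by simp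
  then show ?thesis using integral_eq_0_iff[OF uu ab] s by auto
qed

text \<open>The flat space contains \<open>exp (-1/s) q(s)\<close> for every polynomial
  \<open>q\<close>, so the real and imaginary parts of \<open>H(s) exp (-1/s)\<close> are
  orthogonal to all polynomials. Hence \<open>H\<close> vanishes for \<open>s > 0\<close>, and
  at \<open>0\<close> by continuity.\<close>

lemma orthogonal_to_flat_space_eq_0:
  fixes H :: "real \<Rightarrow> complex"
  assumes t: "0 < t" "t \<le> T" and H: "continuous_on {0..t} H"
    and orth: "\<And>g. g \<in> flat_space T \<Longrightarrow> integral {0..t} (\<lambda>s. H s * g s) = 0"
    and s: "s \<in> {0..t}"
  shows "H s = 0"
proof -
  have T: "T > 0" using t by simp
  define e where "e = flat_exp T 1"
  have e_flat: "(\<lambda>s. complex_of_real (e s)) \<in> flat_space T"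
    unfolding e_def by (rule flat_exp_flat[OF T])
  have "continuous_on {0..T} (\<lambda>s. Re (complex_of_real (e s)))"
    by (intro continuous_intros flat_space_continuous_on e_flat)
  then have e_cont: "continuous_on {0..t} e"
    using t by (auto intro: continuous_on_subset)
  have vanish: "\<phi> (H s) = 0"
    if \<phi>: "bounded_linear \<phi>" "\<And>z c. \<phi> (z * complex_of_real c) = \<phi> z * c" and s: "s \<in> {0<..t}"
    for \<phi> :: "complex \<Rightarrow> real" and s
  proof -
    have cont: "continuous_on {0..t} (\<lambda>s. \<phi> (H s) * e s)"
      by (intro continuous_intros bounded_linear.continuous_on[OF \<phi>(1)] H e_cont)
    have "\<phi> (H s) * e s = 0"
    proof (rule orthogonal_to_polynomials_eq_0[OF t(1) cont])
      fix q :: "real \<Rightarrow> real" assume "real_polynomial_function q"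
      then obtain a n where q: "q = (\<lambda>x. \<Sum>i\<le>n. a i * x ^ i)"
        unfolding real_polynomial_function_iff_sum by blast
      let ?p = "\<Sum>i\<le>n. monom (complex_of_real (a i)) i"
      have p: "poly ?p (of_real x) = of_real (q x)" for x :: real
        by (simp add: q poly_sum poly_monom)
      let ?g = "mult_op ?p (\<lambda>s. complex_of_real (e s))"
      have g: "?g \<in> flat_space T" by (intro flat_space_mult_op T e_flat)
      have int: "(\<lambda>s. H s * ?g s) integrable_on {0..t}"
        using t by (intro integrable_continuous_real continuous_intros H
            continuous_on_subset[OF flat_space_continuous_on[OF g]]) auto
      have "H s * ?g s = H s * complex_of_real (e s * q s)" for s
        unfolding mult_op_def p by (simp add: mult.commute)
      then have "(\<lambda>s. \<phi> (H s) * e s * q s) = \<phi> \<circ> (\<lambda>s. H s * ?g s)"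
        unfolding o_def by (simp only: \<phi>(2) mult.assoc)
      then have "integral {0..t} (\<lambda>s. \<phi> (H s) * e s * q s) = integral {0..t} (\<phi> \<circ> (\<lambda>s. H s * ?g s))"
        by simp
      also have "\<dots> = \<phi> (integral {0..t} (\<lambda>s. H s * ?g s))"
        by (rule integral_linear[OF int \<phi>(1)])
      finally show "integral {0..t} (\<lambda>s. \<phi> (H s) * e s * q s) = 0"
        using orth[OF g] linear_0[OF bounded_linear.linear[OF \<phi>(1)]] by simp
    qed (use s in auto)
    then show ?thesis using s t by (auto simp: e_def flat_exp_def)
  qed
  have pos: "H s = 0" if "s \<in> {0<..t}" for s
    using vanish[OF bounded_linear_Re _ that] vanish[OF bounded_linear_Im _ that]
    by (simp add: complex_eq_iff)
  show ?thesis
  proof (rule continuous_constant_on_closure[of "{0<..t}" H 0])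
    show "continuous_on (closure {0<..t}) H" "s \<in> closure {0<..t}"
      using H s t by (simp_all add: closure_greaterThanAtMost)
  qed (use pos in auto)
qed

text \<open>Among the \<open>\<gamma>\<close> with nonzero coefficient let
  \<open>\<delta>\<close> be the largest, which gives the dominant power as \<open>u
  \<rightarrow> 0\<close>. After division by \<open>u powr (b - \<delta>)\<close> all other
  terms tend to \<open>0\<close>, the flat term \<open>h\<close> included, so the coefficient of
  \<open>\<delta>\<close> is \<open>0\<close>.\<close>

lemma powers_independent_mod_flat:
  fixes c :: "real \<Rightarrow> complex" and h :: "real \<Rightarrow> complex"
  assumes F: "finite F" and t: "t > 0"
    and bound: "\<And>n::nat. \<exists>C. \<forall>u\<in>{0..t}. norm (h u) \<le> C * u ^ n"
    and eq: "\<And>u. u \<in> {0<..t} \<Longrightarrow> (\<Sum>\<gamma>\<in>F. c \<gamma> * of_real (u powr (b - \<gamma>))) + h u = 0"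
    and "\<gamma> \<in> F"
  shows "c \<gamma> = 0"
proof (rule ccontr)
  assume "c \<gamma> \<noteq> 0"
  define G where "G = {\<gamma> \<in> F. c \<gamma> \<noteq> 0}"
  define \<delta> where "\<delta> = Max G"
  have G: "finite G" "G \<noteq> {}" using F \<open>\<gamma> \<in> F\<close> \<open>c \<gamma> \<noteq> 0\<close> by (auto simp: G_def)
  have \<delta>: "\<delta> \<in> G" "\<And>\<gamma>. \<gamma> \<in> G \<Longrightarrow> \<gamma> \<le> \<delta>" using G by (auto simp: \<delta>_def)
  obtain n :: nat where n: "real n > b - \<delta>" using reals_Archimedean2 by blast
  obtain C where C: "\<And>u. u \<in> {0..t} \<Longrightarrow> norm (h u) \<le> C * u ^ n" using bound by blast
  have pow: "((\<lambda>u::real. u powr d) \<longlongrightarrow> 0) (at_right 0)" if "d > 0" for d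
  proof -
    have "((\<lambda>u::real. u powr d) \<longlongrightarrow> 0 powr d) (at_right 0)"
      using that by (intro tendsto_powr') (auto intro!: tendsto_ident_at eventually_mono[OF eventually_at_right_less[of "0::real"]])
    then show ?thesis by simp
  qed
  have single: "((\<lambda>u. c \<gamma> * of_real (u powr (\<delta> - \<gamma>))) \<longlongrightarrow> (if \<gamma> = \<delta> then c \<delta> else 0)) (at_right 0)"
    if "\<gamma> \<in> G" for \<gamma>
  proof (cases "\<gamma> = \<delta>")
    case True
    have "eventually (\<lambda>u. c \<delta> = c \<gamma> * of_real (u powr (\<delta> - \<gamma>))) (at_right (0::real))"
      using eventually_at_right_less[of "0::real"] by eventually_elim (simp add: True)
    then show ?thesis using True by (simp add: Lim_transform_eventually[OF tendsto_const])
  next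
    case False
    then have "\<delta> - \<gamma> > 0" using \<delta>(2)[OF that] by simp
    then have "((\<lambda>u. c \<gamma> * complex_of_real (u powr (\<delta> - \<gamma>))) \<longlongrightarrow> c \<gamma> * complex_of_real 0) (at_right 0)"
      by (intro tendsto_mult tendsto_const tendsto_of_real pow)
    then show ?thesis using False by simp
  qed
  have ev: "eventually (\<lambda>u. u \<in> {0<..<t}) (at_right 0)"
    using t by (rule eventually_at_right_real)
  have "((\<lambda>u. h u * of_real (u powr (\<delta> - b))) \<longlongrightarrow> 0) (at_right 0)"
  proof (rule Lim_null_comparison)
    show "eventually (\<lambda>u. norm (h u * of_real (u powr (\<delta> - b))) \<le> C * u powr (real n + \<delta> - b)) (at_right 0)"
      using ev
    proof eventually_elim
      case (elim u)
      have "norm (h u * of_real (u powr (\<delta> - b))) = norm (h u) * u powr (\<delta> - b)"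
        by (simp add: norm_mult)
      also have "\<dots> \<le> C * u ^ n * u powr (\<delta> - b)"
        using C[of u] elim by (intro mult_right_mono) auto
      also have "u ^ n = u powr real n" using elim by (simp add: powr_realpow)
      also have "C * u powr real n * u powr (\<delta> - b) = C * u powr (real n + (\<delta> - b))"
        by (simp only: mult.assoc powr_add)
      finally show ?case by (simp only: add_diff_eq)
    qed
    show "((\<lambda>u. C * u powr (real n + \<delta> - b)) \<longlongrightarrow> 0) (at_right 0)"
      using n by (intro tendsto_mult_right_zero pow) auto
  qed
  then have "((\<lambda>u. (\<Sum>\<gamma>\<in>G. c \<gamma> * of_real (u powr (\<delta> - \<gamma>))) + h u * of_real (u powr (\<delta> - b)))
      \<longlongrightarrow> (\<Sum>\<gamma>\<in>G. if \<gamma> = \<delta> then c \<delta> else 0) + 0) (at_right 0)"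
    using single by (intro tendsto_add tendsto_sum) auto
  moreover have "eventually (\<lambda>u. (\<Sum>\<gamma>\<in>G. c \<gamma> * of_real (u powr (\<delta> - \<gamma>))) + h u * of_real (u powr (\<delta> - b)) = 0) (at_right 0)"
    using ev
  proof eventually_elim
    case (elim u)
    have "(\<Sum>\<gamma>\<in>G. c \<gamma> * of_real (u powr (\<delta> - \<gamma>))) + h u * of_real (u powr (\<delta> - b))
        = ((\<Sum>\<gamma>\<in>G. c \<gamma> * of_real (u powr (b - \<gamma>))) + h u) * of_real (u powr (\<delta> - b))"
    proof -
      have "c \<gamma> * complex_of_real (u powr (\<delta> - \<gamma>))
          = c \<gamma> * of_real (u powr (b - \<gamma>)) * of_real (u powr (\<delta> - b))" for \<gamma>
        using powr_add[of u "b - \<gamma>" "\<delta> - b"] by simp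
      then have "(\<Sum>\<gamma>\<in>G. c \<gamma> * complex_of_real (u powr (\<delta> - \<gamma>)))
          = (\<Sum>\<gamma>\<in>G. c \<gamma> * of_real (u powr (b - \<gamma>))) * of_real (u powr (\<delta> - b))"
        unfolding sum_distrib_right by (intro sum.cong refl)
      then show ?thesis unfolding distrib_right by (rule arg_cong)
    qed
    also have "(\<Sum>\<gamma>\<in>G. c \<gamma> * of_real (u powr (b - \<gamma>))) = (\<Sum>\<gamma>\<in>F. c \<gamma> * of_real (u powr (b - \<gamma>)))"
      using F by (intro sum.mono_neutral_left) (auto simp: G_def)
    finally show ?case using eq[of u] elim by simp
  qed
  ultimately have "((\<lambda>u::real. 0) \<longlongrightarrow> (\<Sum>\<gamma>\<in>G. if \<gamma> = \<delta> then c \<delta> else 0) + 0) (at_right 0)"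
    by (rule Lim_transform_eventually)
  then have "(\<Sum>\<gamma>\<in>G. if \<gamma> = \<delta> then c \<delta> else 0) + 0 = 0"
    by (intro tendsto_unique[OF trivial_limit_at_right_real _ tendsto_const])
  then show False using G \<delta> by (simp add: G_def)
qed

section \<open>Volterra operators and normal forms\<close>

text \<open>For fixed \<open>t\<close> a flat kernel is an ordinary flat convolution kernel. The
  uniqueness proof sees bivariate kernels only through these slices.\<close>

lemma flat_kernel_slice:
  assumes T: "T > 0" and K: "K \<in> flat_kernels T" and t: "t \<in> {0..T}"
  obtains k where "k \<in> flat_space T" "\<And>s. s \<in> {0..t} \<Longrightarrow> K (t, s) = k (t - s)"
    "\<And>f. volterra_op T K f t = conv_op T k f t"
proof -
  obtain N :: nat and p kk where kk: "\<And>r. r \<in> {1..N} \<Longrightarrow> kk r \<in> flat_space T"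
    and KK: "\<And>t s. K (t, s) = (if (t, s) \<in> triangle T then \<Sum>r=1..N. poly (p r) (of_real t) * kk r (t - s) else 0)"
    using K unfolding flat_kernels_def by blast
  define k where "k u = (\<Sum>r=1..N. poly (p r) (of_real t) * kk r u)" for u
  have "k \<in> flat_space T"
    unfolding k_def[abs_def] using kk by (intro flat_space_sum flat_space_cmult T) auto
  moreover have eq: "K (t, s) = k (t - s)" if "s \<in> {0..t}" for s
    using that t by (simp add: KK triangle_def k_def)
  moreover have "volterra_op T K f t = conv_op T k f t" for f
    using t eq by (auto simp: volterra_op_def conv_op_def intro!: integral_cong)
  ultimately show ?thesis using that by blast
qed

lemma flat_kernels_outside: "K \<in> flat_kernels T \<Longrightarrow> (t, s) \<notin> triangle T \<Longrightarrow> K (t, s) = 0"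
  by (auto simp: flat_kernels_def)

lemma flat_kernelsI:
  fixes N :: nat
  assumes "\<And>r. r \<in> {1..N} \<Longrightarrow> k r \<in> flat_space T"
    and "\<And>t s. K (t, s) = (if (t, s) \<in> triangle T then \<Sum>r=1..N. poly (p r) (of_real t) * k r (t - s) else 0)"
  shows "K \<in> flat_kernels T"
  using assms unfolding flat_kernels_def by blast

lemma flat_kernels_zero: "(\<lambda>x. 0) \<in> flat_kernels T"
  by (rule flat_kernelsI[where N = 0]) auto

lemma flat_kernels_single:
  assumes "k \<in> flat_space T"
  shows "(\<lambda>(t, s). if (t, s) \<in> triangle T then poly p (of_real t) * k (t - s) else 0) \<in> flat_kernels T"
  by (rule flat_kernelsI[where N = 1 and k = "\<lambda>r. k" and p = "\<lambda>r. p"]) (use assms in auto)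

lemma flat_kernels_add:
  assumes "K \<in> flat_kernels T" "L \<in> flat_kernels T"
  shows "(\<lambda>x. K x + L x) \<in> flat_kernels T"
proof -
  obtain N :: nat and p k where k: "\<And>r. r \<in> {1..N} \<Longrightarrow> k r \<in> flat_space T"
    and K: "\<And>t s. K (t, s) = (if (t, s) \<in> triangle T then \<Sum>r=1..N. poly (p r) (of_real t) * k r (t - s) else 0)"
    using assms(1) unfolding flat_kernels_def by blast
  obtain M :: nat and q l where l: "\<And>r. r \<in> {1..M} \<Longrightarrow> l r \<in> flat_space T"
    and L: "\<And>t s. L (t, s) = (if (t, s) \<in> triangle T then \<Sum>r=1..M. poly (q r) (of_real t) * l r (t - s) else 0)"
    using assms(2) unfolding flat_kernels_def by blast
  show ?thesis
  proof (rule flat_kernelsI[where N = "N + M" and k = "\<lambda>r. if r \<le> N then k r else l (r - N)"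
        and p = "\<lambda>r. if r \<le> N then p r else q (r - N)"])
    show "(if r \<le> N then k r else l (r - N)) \<in> flat_space T" if "r \<in> {1..N + M}" for r
    proof (cases "r \<le> N")
      case False
      then have "r - N \<in> {1..M}" using that by auto
      with False show ?thesis using l by simp
    qed (use that k in auto)
    fix t s
    let ?S = "\<lambda>A. \<Sum>r\<in>A. poly (if r \<le> N then p r else q (r - N)) (of_real t)
                         * (if r \<le> N then k r else l (r - N)) (t - s)"
    have "?S {1..N + M} = ?S {1..N} + ?S {N + 1..N + M}"
      by (rule sum.ub_add_nat) auto
    also have "?S {1..N} = (\<Sum>r=1..N. poly (p r) (of_real t) * k r (t - s))"
      by (intro sum.cong) auto
    also have "?S {N + 1..N + M} = (\<Sum>r=1..M. poly (q r) (of_real t) * l r (t - s))"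
      by (rule sum.reindex_bij_witness[of _ "\<lambda>r. r + N" "\<lambda>r. r - N"]) auto
    finally show "K (t, s) + L (t, s) = (if (t, s) \<in> triangle T then ?S {1..N + M} else 0)"
      by (simp add: K L)
  qed
qed

lemma flat_kernels_cmult:
  assumes "K \<in> flat_kernels T"
  shows "(\<lambda>x. c * K x) \<in> flat_kernels T"
proof -
  obtain N :: nat and p k where k: "\<And>r. r \<in> {1..N} \<Longrightarrow> k r \<in> flat_space T"
    and K: "\<And>t s. K (t, s) = (if (t, s) \<in> triangle T then \<Sum>r=1..N. poly (p r) (of_real t) * k r (t - s) else 0)"
    using assms(1) unfolding flat_kernels_def by blast
  show ?thesis
    by (rule flat_kernelsI[where N = N and k = k and p = "\<lambda>r. smult c (p r)"])
      (use k in \<open>auto simp: K sum_distrib_left mult.assoc\<close>)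
qed

lemma volterra_op_add:
  assumes T: "T > 0" and K: "K \<in> flat_kernels T" and L: "L \<in> flat_kernels T" and f: "f \<in> flat_space T"
  shows "volterra_op T (\<lambda>x. K x + L x) f = (\<lambda>t. volterra_op T K f t + volterra_op T L f t)"
proof
  fix t show "volterra_op T (\<lambda>x. K x + L x) f t = volterra_op T K f t + volterra_op T L f t"
  proof (cases "t \<in> {0..T}")
    case t: True
    obtain k where k: "k \<in> flat_space T" "\<And>s. s \<in> {0..t} \<Longrightarrow> K (t, s) = k (t - s)"
      "\<And>f. volterra_op T K f t = conv_op T k f t"
      using flat_kernel_slice[OF T K t] by blast
    obtain l where l: "l \<in> flat_space T" "\<And>s. s \<in> {0..t} \<Longrightarrow> L (t, s) = l (t - s)"
      "\<And>f. volterra_op T L f t = conv_op T l f t"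
      using flat_kernel_slice[OF T L t] by blast
    have "volterra_op T (\<lambda>x. K x + L x) f t = conv_op T (\<lambda>u. k u + l u) f t"
      using t k(2) l(2) by (auto simp: volterra_op_def conv_op_def intro!: integral_cong)
    then show ?thesis
      using conv_op_add_left[of k l f T] flat_space_causal[OF T] k l f by simp
  qed (auto simp: volterra_op_def)
qed

lemma volterra_op_cmult: "volterra_op T (\<lambda>x. c * K x) f = (\<lambda>t. c * volterra_op T K f t)"
  by (auto simp: volterra_op_def fun_eq_iff mult.assoc)

lemma volterra_op_single:
  "volterra_op T (\<lambda>(t, s). if (t, s) \<in> triangle T then poly p (of_real t) * k (t - s) else 0) f
    = mult_op p (conv_op T k f)"
proof
  fix t
  show "volterra_op T (\<lambda>(t, s). if (t, s) \<in> triangle T then poly p (of_real t) * k (t - s) else 0) f t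
      = mult_op p (conv_op T k f) t"
  proof (cases "t \<in> {0..T}")
    case True
    then have "integral {0..t} (\<lambda>s. (if (t, s) \<in> triangle T then poly p (of_real t) * k (t - s) else 0) * f s)
        = integral {0..t} (\<lambda>s. poly p (of_real t) * (k (t - s) * f s))"
      by (intro integral_cong) (simp add: triangle_def)
    then show ?thesis using True by (simp add: volterra_op_def mult_op_def conv_op_def)
  qed (auto simp: volterra_op_def mult_op_def conv_op_def)
qed

lemma mult_op_add_left: "mult_op (p + q) f t = mult_op p f t + mult_op q f t"
  by (simp add: mult_op_def distrib_right)

lemma sum_mult_op_extend:
  assumes "finite G" "F \<subseteq> G"
  shows "(\<Sum>\<gamma>\<in>G. mult_op (if \<gamma> \<in> F then p \<gamma> else 0) (D \<gamma>) t) = (\<Sum>\<gamma>\<in>F. mult_op (p \<gamma>) (D \<gamma>) t)"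
  using assms by (intro sum.mono_neutral_cong_right) (auto simp: mult_op_def)

lemma is_representation_apply:
  assumes "is_representation T \<Gamma> A F p K" "f \<in> flat_space T"
  shows "A f t = (\<Sum>\<gamma>\<in>F. mult_op (p \<gamma>) (frac_deriv T \<gamma> f) t) + volterra_op T K f t"
  using assms by (simp add: is_representation_def)

lemma representable_normal_form:
  assumes T: "T > 0" and A: "representable T \<Gamma> A"
  shows "\<exists>F p K. is_representation T \<Gamma> (restrict A (flat_space T)) F p K"
  using A
proof induction
  case (representable_deriv \<gamma> p)
  have "volterra_op T (\<lambda>x. 0) f t = 0" for f t by (simp add: volterra_op_def)
  then show ?case
    using representable_deriv flat_kernels_zero
    by (intro exI[of _ "{\<gamma>}"] exI[of _ "\<lambda>_. p"] exI[of _ "\<lambda>x. 0"]) (simp add: is_representation_def restrict_def)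
next
  case (representable_conv k p)
  show ?case
    by (intro exI[of _ "{}"] exI[of _ "\<lambda>_. 0"]
        exI[of _ "\<lambda>(t, s). if (t, s) \<in> triangle T then poly p (of_real t) * k (t - s) else 0"])
      (simp add: is_representation_def flat_kernels_single representable_conv volterra_op_single restrict_def)
next
  case (representable_add A B)
  then obtain F p K G q L where A: "is_representation T \<Gamma> (restrict A (flat_space T)) F p K"
    and B: "is_representation T \<Gamma> (restrict B (flat_space T)) G q L" by blast
  let ?p = "\<lambda>\<gamma>. (if \<gamma> \<in> F then p \<gamma> else 0) + (if \<gamma> \<in> G then q \<gamma> else 0)"
  have fin: "finite F" "finite G" using A B by (auto simp: is_representation_def)
  have K: "K \<in> flat_kernels T" and L: "L \<in> flat_kernels T" using A B by (auto simp: is_representation_def)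
  have "A f t + B f t = (\<Sum>\<gamma>\<in>F \<union> G. mult_op (?p \<gamma>) (frac_deriv T \<gamma> f) t) + volterra_op T (\<lambda>x. K x + L x) f t"
    if f: "f \<in> flat_space T" for f t
  proof -
    have "A f t = (\<Sum>\<gamma>\<in>F. mult_op (p \<gamma>) (frac_deriv T \<gamma> f) t) + volterra_op T K f t"
      using is_representation_apply[OF A f] f by simp
    moreover have "B f t = (\<Sum>\<gamma>\<in>G. mult_op (q \<gamma>) (frac_deriv T \<gamma> f) t) + volterra_op T L f t"
      using is_representation_apply[OF B f] f by simp
    ultimately show ?thesis
      using fin by (simp add: mult_op_add_left sum.distrib sum_mult_op_extend volterra_op_add[OF T K L f])
  qed
  then have "is_representation T \<Gamma> (\<lambda>f\<in>flat_space T. \<lambda>t. A f t + B f t) (F \<union> G) ?p (\<lambda>x. K x + L x)"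
    using A B flat_kernels_add[OF K L] by (auto simp: is_representation_def intro!: restrict_ext)
  then show ?case by blast
next
  case (representable_cong A B)
  then have "restrict A (flat_space T) = restrict B (flat_space T)" by (intro restrict_ext) auto
  then show ?case using representable_cong.IH by simp
qed

section \<open>Uniqueness of the normal form\<close>

text \<open>Composition with \<open>D\<^bsup>-m\<^esup>\<close> below turns a sum of fractional
  derivatives at a point into one convolution with the corresponding linear combination of
  fractional kernels.\<close>

lemma conv_op_sum_left:
  assumes "finite I" "\<And>i. i \<in> I \<Longrightarrow> k i \<in> causal_kernels" "f \<in> bounded_causal"
  shows "conv_op T (\<lambda>u. \<Sum>i\<in>I. c i * k i u) f t = (\<Sum>i\<in>I. c i * conv_op T (k i) f t)"
proof (cases "t \<in> {0..T}")
  case True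
  have "integral {0..t} (\<lambda>s. \<Sum>i\<in>I. c i * (k i (t - s) * f s)) = (\<Sum>i\<in>I. integral {0..t} (\<lambda>s. c i * (k i (t - s) * f s)))"
    using assms by (intro integral_sum) (auto intro!: integrable_on_mult_right conv_op_integrable)
  then show ?thesis using True by (simp add: conv_op_def sum_distrib_right mult.assoc)
qed (auto simp: conv_op_def)

lemma causal_kernels_sum:
  assumes "\<And>i. i \<in> I \<Longrightarrow> k i \<in> causal_kernels"
  shows "(\<lambda>u. \<Sum>i\<in>I. c i * k i u) \<in> causal_kernels"
  using assms by (auto simp: causal_kernels_def intro!: sum.neutral)

lemma conv_op_eq_0_imp_kernel_eq_0:
  assumes t: "0 < t" "t \<le> T" and k: "continuous_on {0..t} k"
    and 0: "\<And>g. g \<in> flat_space T \<Longrightarrow> conv_op T k g t = 0" and u: "u \<in> {0..t}"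
  shows "k u = 0"
proof -
  have "k (t - (t - u)) = 0"
  proof (rule orthogonal_to_flat_space_eq_0[OF t, of "\<lambda>s. k (t - s)" "t - u"])
    show "continuous_on {0..t} (\<lambda>s. k (t - s))"
      by (rule continuous_on_compose2[OF k]) (auto intro!: continuous_intros)
    show "integral {0..t} (\<lambda>s. k (t - s) * g s) = 0" if "g \<in> flat_space T" for g
      using 0[OF that] t by (simp add: conv_op_def)
  qed (use u in auto)
  then show ?thesis by simp
qed

lemma frac_kernel_continuous_on:
  assumes "\<mu> > 1" "t \<le> T"
  shows "continuous_on {0..t} (frac_kernel T \<mu>)"
proof -
  have "continuous_on {0..t} (\<lambda>u. complex_of_real (u powr (\<mu> - 1) / Gamma \<mu>))"
    using assms by (intro continuous_intros continuous_on_powr') (auto simp: Gamma_eq_zero_iff)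
  then show ?thesis
    by (rule continuous_on_eq) (use assms in \<open>auto simp: frac_kernel_def\<close>)
qed

text \<open>Inserting \<open>f = D\<^bsup>-m\<^esup> g\<close> with large \<open>m\<close> makes
  the left-hand side at \<open>t\<close> a convolution of \<open>g\<close> with the continuous
  kernel \<open>S + h\<close>, where \<open>S\<close> collects the powers \<open>u powr (m -
  \<gamma> - 1)\<close> and \<open>h\<close> is flat. This kernel vanishes because
  \<open>g\<close> is arbitrary, and then its coefficients vanish by their orders of
  growth.\<close>

lemma zero_representation_coeff:
  assumes T: "T > 0" and F: "finite F" and K: "K \<in> flat_kernels T"
    and 0: "\<And>f t. f \<in> flat_space T \<Longrightarrow>
      (\<Sum>\<gamma>\<in>F. mult_op (p \<gamma>) (frac_deriv T \<gamma> f) t) + volterra_op T K f t = 0"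
    and t: "0 < t" "t \<le> T" and \<delta>: "\<delta> \<in> F"
  shows "poly (p \<delta>) (of_real t) = 0"
proof -
  have t': "t \<in> {0..T}" using t by simp
  obtain k where k: "k \<in> flat_space T" "\<And>f. volterra_op T K f t = conv_op T k f t"
    using flat_kernel_slice[OF T K t'] by metis
  \<comment> \<open>Orders below \<open>-1\<close> make the fractional kernels continuous at \<open>0\<close>; inserting \<open>0\<close> covers empty \<open>F\<close>.\<close>
  obtain m :: nat where "real m > Max (insert 0 F) + 1" using reals_Archimedean2 by blast
  have m: "real m - \<gamma> > 1" if "\<gamma> \<in> F" for \<gamma>
  proof -
    have "\<gamma> \<le> Max (insert 0 F)" using F that by (intro Max_ge) auto
    then show ?thesis using \<open>real m > Max (insert 0 F) + 1\<close> by linarith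
  qed
  define h where "h = frac_deriv T (- real m) k"
  have h: "h \<in> flat_space T" unfolding h_def by (intro frac_deriv_flat T k)
  define S where "S = (\<lambda>u. \<Sum>\<gamma>\<in>F. poly (p \<gamma>) (of_real t) * frac_kernel T (real m - \<gamma>) u)"
  have fk: "frac_kernel T (real m - \<gamma>) \<in> causal_kernels" if "\<gamma> \<in> F" for \<gamma>
    using m[OF that] by (intro frac_kernel_causal T) auto
  have S: "S \<in> causal_kernels"
    unfolding S_def by (intro causal_kernels_sum fk)
  have conv0: "conv_op T (\<lambda>u. S u + h u) g t = 0" if g: "g \<in> flat_space T" for g
  proof -
    have gb: "g \<in> bounded_causal" using flat_space_causal[OF T g] by simp
    have f: "frac_deriv T (- real m) g \<in> flat_space T" by (intro frac_deriv_flat T g)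
    have "frac_deriv T \<gamma> (frac_deriv T (- real m) g) = conv_op T (frac_kernel T (real m - \<gamma>)) g" if "\<gamma> \<in> F" for \<gamma>
    proof -
      have "frac_deriv T \<gamma> (frac_deriv T (- real m) g) = frac_deriv T (\<gamma> - real m) g"
        by (simp add: frac_deriv_compose[OF T g])
      also have "\<dots> = frac_int T (real m - \<gamma>) g"
        using m[OF that] by (simp add: frac_deriv_def)
      finally show ?thesis by (simp only: frac_int_eq_conv_op)
    qed
    then have "(\<Sum>\<gamma>\<in>F. mult_op (p \<gamma>) (frac_deriv T \<gamma> (frac_deriv T (- real m) g)) t) = conv_op T S g t"
      unfolding S_def using conv_op_sum_left[OF F fk gb] by (simp add: mult_op_def)
    moreover have "volterra_op T K (frac_deriv T (- real m) g) t = conv_op T h g t"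
      by (simp add: k(2) h_def conv_op_frac_deriv[OF T k(1) g])
    ultimately show ?thesis
      using 0[OF f, of t] conv_op_add_left[OF S flat_space_causal(1)[OF T h] gb, of T] by simp
  qed
  have cont: "continuous_on {0..t} (\<lambda>u. S u + h u)"
    unfolding S_def using t m
    by (intro continuous_intros frac_kernel_continuous_on continuous_on_subset[OF flat_space_continuous_on[OF h]]) auto
  have "poly (p \<delta>) (of_real t) / of_real (Gamma (real m - \<delta>)) = 0"
  proof (rule powers_independent_mod_flat[OF F t(1) _ _ \<delta>, where h = h and b = "real m - 1"])
    show "\<exists>C. \<forall>u\<in>{0..t}. norm (h u) \<le> C * u ^ n" for n
    proof -
      obtain C where "\<forall>u\<in>{0..T}. norm (h u) \<le> C * u ^ n" using flat_space_bound[OF T h] by blast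
      then show ?thesis using t by (intro exI[of _ C]) auto
    qed
    fix u assume u: "u \<in> {0<..t}"
    have "S u + h u = 0"
      by (rule conv_op_eq_0_imp_kernel_eq_0[OF t cont conv0]) (use u in auto)
    moreover have "S u = (\<Sum>\<gamma>\<in>F. poly (p \<gamma>) (of_real t) / of_real (Gamma (real m - \<gamma>)) * of_real (u powr (real m - 1 - \<gamma>)))"
      unfolding S_def using u t by (intro sum.cong) (auto simp: frac_kernel_def algebra_simps)
    ultimately show "(\<Sum>\<gamma>\<in>F. poly (p \<gamma>) (of_real t) / of_real (Gamma (real m - \<gamma>)) * of_real (u powr (real m - 1 - \<gamma>))) + h u = 0"
      by simp
  qed
  moreover have "Gamma (real m - \<delta>) \<noteq> 0"
  proof -
    have "0 < real m - \<delta>" using m[OF \<delta>] by linarith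
    then show ?thesis by (metis Gamma_real_pos less_irrefl)
  qed
  ultimately show ?thesis by simp
qed

text \<open>A polynomial vanishing on \<open>(0, T]\<close> is zero. Then \<open>V\<^sub>K =
  0\<close>, which says that every slice of \<open>K\<close> is orthogonal to the flat
  space.\<close>

lemma zero_representation:
  assumes T: "T > 0" and F: "finite F" and K: "K \<in> flat_kernels T"
    and 0: "\<And>f t. f \<in> flat_space T \<Longrightarrow>
      (\<Sum>\<gamma>\<in>F. mult_op (p \<gamma>) (frac_deriv T \<gamma> f) t) + volterra_op T K f t = 0"
  shows "\<And>\<gamma>. \<gamma> \<in> F \<Longrightarrow> p \<gamma> = 0" and "K = (\<lambda>_. 0)"
proof -
  show p: "p \<gamma> = 0" if "\<gamma> \<in> F" for \<gamma>
  proof (rule ccontr)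
    assume "p \<gamma> \<noteq> 0"
    then have "finite {x. poly (p \<gamma>) x = 0}" by (rule poly_roots_finite)
    moreover have "complex_of_real ` {0<..T} \<subseteq> {x. poly (p \<gamma>) x = 0}"
      using zero_representation_coeff[OF assms _ _ that] by auto
    ultimately have "finite (complex_of_real ` {0<..T})" by (rule rev_finite_subset)
    then have "finite {0<..T}" by (rule finite_imageD) (simp add: inj_on_def)
    then show False using T infinite_Ioc by blast
  qed
  have V0: "volterra_op T K f t = 0" if "f \<in> flat_space T" for f t
    using 0[OF that, of t] p by (simp add: mult_op_def)
  have "K (t, s) = 0" for t s
  proof (cases "(t, s) \<in> triangle T")
    case True
    then have t: "t \<in> {0..T}" and s: "s \<in> {0..t}" by (auto simp: triangle_def)
    obtain k where k: "k \<in> flat_space T" "\<And>s. s \<in> {0..t} \<Longrightarrow> K (t, s) = k (t - s)"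
      "\<And>f. volterra_op T K f t = conv_op T k f t"
      using flat_kernel_slice[OF T K t] by blast
    have "k (t - s) = 0"
    proof (cases "t = 0")
      case True
      then show ?thesis using s flat_space_at_0[OF k(1)] by simp
    next
      case False
      show ?thesis
      proof (rule conv_op_eq_0_imp_kernel_eq_0[of t T k])
        show "continuous_on {0..t} k"
          using t by (intro continuous_on_subset[OF flat_space_continuous_on[OF k(1)]]) auto
        show "conv_op T k g t = 0" if "g \<in> flat_space T" for g
          using V0[OF that, of t] k(3)[of g] by simp
      qed (use False t s in auto)
    qed
    then show ?thesis using k(2)[OF s] by simp
  qed (rule flat_kernels_outside[OF K])
  then show "K = (\<lambda>_. 0)" by auto
qed

lemma representation_unique:
  assumes T: "T > 0" and A: "is_representation T \<Gamma> A F p K" and A': "is_representation T \<Gamma> A F' p' K'"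
  shows "(if \<gamma> \<in> F then p \<gamma> else 0) = (if \<gamma> \<in> F' then p' \<gamma> else 0)" and "K = K'"
proof -
  have fin: "finite F" "finite F'" and K: "K \<in> flat_kernels T" and K': "K' \<in> flat_kernels T"
    using A A' by (auto simp: is_representation_def)
  let ?q = "\<lambda>\<gamma>. (if \<gamma> \<in> F then p \<gamma> else 0) + (if \<gamma> \<in> F' then - p' \<gamma> else 0)"
  let ?L = "\<lambda>x. K x + (-1) * K' x"
  have L: "?L \<in> flat_kernels T" by (intro flat_kernels_add flat_kernels_cmult K K')
  have 0: "(\<Sum>\<gamma>\<in>F \<union> F'. mult_op (?q \<gamma>) (frac_deriv T \<gamma> f) t) + volterra_op T ?L f t = 0"
    if f: "f \<in> flat_space T" for f t
  proof -
    have "A f t = (\<Sum>\<gamma>\<in>F. mult_op (p \<gamma>) (frac_deriv T \<gamma> f) t) + volterra_op T K f t"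
      by (rule is_representation_apply[OF A f])
    moreover have "A f t = (\<Sum>\<gamma>\<in>F'. mult_op (p' \<gamma>) (frac_deriv T \<gamma> f) t) + volterra_op T K' f t"
      by (rule is_representation_apply[OF A' f])
    moreover have "(\<Sum>\<gamma>\<in>F'. mult_op (- p' \<gamma>) (frac_deriv T \<gamma> f) t) = - (\<Sum>\<gamma>\<in>F'. mult_op (p' \<gamma>) (frac_deriv T \<gamma> f) t)"
      by (simp add: mult_op_def sum_negf)
    moreover have "volterra_op T ?L f t = volterra_op T K f t + (-1) * volterra_op T K' f t"
      unfolding volterra_op_add[OF T K flat_kernels_cmult[OF K'] f] volterra_op_cmult ..
    moreover have "(\<Sum>\<gamma>\<in>F \<union> F'. mult_op (?q \<gamma>) (frac_deriv T \<gamma> f) t)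
        = (\<Sum>\<gamma>\<in>F. mult_op (p \<gamma>) (frac_deriv T \<gamma> f) t) + (\<Sum>\<gamma>\<in>F'. mult_op (- p' \<gamma>) (frac_deriv T \<gamma> f) t)"
      using fin by (simp add: mult_op_add_left sum.distrib sum_mult_op_extend)
    ultimately show ?thesis by (simp only:) (simp add: algebra_simps)
  qed
  have "?q \<gamma> = 0" if "\<gamma> \<in> F \<union> F'"
    by (rule zero_representation(1)[OF T finite_UnI[OF fin] L _ that]) (rule 0)
  then show "(if \<gamma> \<in> F then p \<gamma> else 0) = (if \<gamma> \<in> F' then p' \<gamma> else 0)"
    by (auto split: if_splits)
  show "K = K'"
    using zero_representation(2)[OF T finite_UnI[OF fin] L, of ?q] 0 by (simp add: fun_eq_iff)
qed

theorem theorem1: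
  fixes T :: real and \<Gamma> :: "real set" and A :: "(real \<Rightarrow> complex) \<Rightarrow> (real \<Rightarrow> complex)"
  assumes "T > 0"
    and "\<int> \<subseteq> \<Gamma>"
    and "\<And>x y. x \<in> \<Gamma> \<Longrightarrow> y \<in> \<Gamma> \<Longrightarrow> x + y \<in> \<Gamma>"
    and "\<And>x. x \<in> \<Gamma> \<Longrightarrow> - x \<in> \<Gamma>"
    and "A \<in> frac_algebra T \<Gamma>"
  shows "(\<exists>F p K. is_representation T \<Gamma> A F p K)
    \<and> (\<forall>F p K F' p' K'.
         is_representation T \<Gamma> A F p K \<longrightarrow> is_representation T \<Gamma> A F' p' K' \<longrightarrow>
         (\<forall>\<gamma>. (if \<gamma> \<in> F then p \<gamma> else 0) = (if \<gamma> \<in> F' then p' \<gamma> else 0)) \<and> K = K')"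
proof
  obtain A' where "representable T \<Gamma> A'" "A = restrict A' (flat_space T)"
    using frac_algebra_representable[OF assms(1,2,3,5)] by blast
  then show "\<exists>F p K. is_representation T \<Gamma> A F p K"
    using representable_normal_form[OF assms(1)] by blast
qed (use representation_unique[OF assms(1)] in blast)

end
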